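(* Let $k\ge 1$ and suppose $G_k=2^{2k+1}+2^{k+1}+1$ is prime. Let $m$ be an integer with $m\not\equiv 0\pmod{G_k}$ that is a fourth power modulo $G_k$, and let $E(G_k)$ be the group of $\mathbb{F}_{G_k}$-rational points of the elliptic curve $E:y^2=x^3-mx$. Then \[E(G_k)\cong \mathbb{Z}/2^{k}\mathbb{Z}\oplus \mathbb{Z}/2^{k+1}\mathbb{Z}.\] *)

theory Defs
  imports "HOL-Number_Theory.Residues" "HOL-Algebra.Elementary_Groups"
begin

datatype 'a ec_point = Infinity | Point 'a 'a

(* Points with coordinates in R of the projective closure of y^2 = x^3 + a x + b:
   the affine solutions and the single point at infinity. *)
definition ec_points :: "('a, 'r) ring_scheme \<Rightarrow> 'a \<Rightarrow> 'a \<Rightarrow> 'a ec_point set"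
  where
  "ec_points R a b =
     insert Infinity
       {Point x y | x y. x \<in> carrier R \<and> y \<in> carrier R \<and>
          y [^]\<^bsub>R\<^esub> (2::nat) =
            x [^]\<^bsub>R\<^esub> (3::nat) \<oplus>\<^bsub>R\<^esub> a \<otimes>\<^bsub>R\<^esub> x \<oplus>\<^bsub>R\<^esub> b}"

(* The line through P1 and P2 (the tangent line if P1 = P2) of slope l meets the curve in a third
   point, whose reflection in the x-axis is the sum.  On the curve, equal x-coordinates force
   y2 = y1 or y2 = - y1; the second case (a vertical line) gives the point at infinity, and it
   includes doubling a point with y1 = 0. *)
definition ec_slope ::
    "('a, 'r) ring_scheme \<Rightarrow> 'a \<Rightarrow> 'a \<Rightarrow> 'a \<Rightarrow> 'a \<Rightarrow> 'a \<Rightarrow> 'a"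
  where
  "ec_slope R a x1 y1 x2 y2 =
     (if x1 = x2
      then ([(3::nat)] \<cdot>\<^bsub>R\<^esub> (x1 [^]\<^bsub>R\<^esub> (2::nat)) \<oplus>\<^bsub>R\<^esub> a)
             \<otimes>\<^bsub>R\<^esub> inv\<^bsub>R\<^esub> ([(2::nat)] \<cdot>\<^bsub>R\<^esub> y1)
      else (y2 \<ominus>\<^bsub>R\<^esub> y1) \<otimes>\<^bsub>R\<^esub> inv\<^bsub>R\<^esub> (x2 \<ominus>\<^bsub>R\<^esub> x1))"

fun ec_add ::
    "('a, 'r) ring_scheme \<Rightarrow> 'a \<Rightarrow> 'a ec_point \<Rightarrow> 'a ec_point \<Rightarrow> 'a ec_point"
  where
  "ec_add R a Infinity Q = Q"
| "ec_add R a (Point x1 y1) Infinity = Point x1 y1"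
| "ec_add R a (Point x1 y1) (Point x2 y2) =
     (if x1 = x2 \<and> y2 = \<ominus>\<^bsub>R\<^esub> y1 then Infinity
      else
        let l = ec_slope R a x1 y1 x2 y2;
            x3 = l [^]\<^bsub>R\<^esub> (2::nat) \<ominus>\<^bsub>R\<^esub> x1 \<ominus>\<^bsub>R\<^esub> x2
        in Point x3 (l \<otimes>\<^bsub>R\<^esub> (x1 \<ominus>\<^bsub>R\<^esub> x3) \<ominus>\<^bsub>R\<^esub> y1))"

(* The group of R-rational points of y^2 = x^3 + a x + b.  It is a group when R is a field of
   characteristic other than 2 and 3 and the discriminant -16 (4 a^3 + 27 b^2) is nonzero. *)
definition ec_group :: "('a, 'r) ring_scheme \<Rightarrow> 'a \<Rightarrow> 'a \<Rightarrow> 'a ec_point monoid"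
  where
  "ec_group R a b = \<lparr>carrier = ec_points R a b, monoid.mult = ec_add R a, one = Infinity\<rparr>"

definition Gnum :: "nat \<Rightarrow> int"
  where "Gnum k = 2 ^ (2 * k + 1) + 2 ^ (k + 1) + 1"

end

theory Submission
  imports Defs "HOL-Library.Set_Algebras" "Berlekamp_Zassenhaus.Finite_Field"
begin

text \<open>Write \<open>p = G\<^sub>k = (2\<^sup>k + 1)\<^sup>2 + (2\<^sup>k)\<^sup>2\<close>.  Since \<open>m\<close> is a fourth power, scaling reduces the claim to
  \<open>y\<^sup>2 = x\<^sup>3 - x\<close>.  The chord-tangent law is associative because \<open>P \<mapsto> (X - x\<^sub>P, Y - y\<^sub>P)\<close> turns it into
  the product of ideal classes of the coordinate ring, and distinct points have distinct classes by a
  degree argument on norms.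

  Jacobsthal's identity expresses \<open>4 p\<close> as \<open>S(1)\<^sup>2 + S(N)\<^sup>2\<close>, where \<open>S(n)\<close> is the sum of the quadratic
  character of \<open>x\<^sup>3 - n x\<close> and \<open>N\<close> is a nonsquare.  As \<open>p\<close> is a sum of two squares in only one way and
  the group order \<open>p + 1 + S(1)\<close> is divisible by 8, the order is \<open>2\<close> to the power \<open>2 k + 1\<close>.

  The automorphism \<open>(x, y) \<mapsto> (- x, i y)\<close> makes the group a module over the Gaussian integers in which
  \<open>1 + i\<close> has a kernel of order 2.  So its powers form a descending chain of index 2 steps; a point
  \<open>P\<close> outside the image of \<open>1 + i\<close> generates the module, and \<open>P\<close> and \<open>(1 + i) P\<close> generate the two
  cyclic factors.\<close>

section \<open>The coordinate ring of the curve and its ideal classes\<close>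

text \<open>Submodules of a ring over itself are its ideals, so \<open>ideal.span S\<close> is the
  ideal generated by \<open>S\<close>.\<close>

interpretation ideal: Modules.module "(*) :: 'r::comm_ring_1 \<Rightarrow> 'r \<Rightarrow> 'r"
  by standard (simp_all add: algebra_simps)

declare ideal.scale_scale [simp del] \<comment> \<open>loops with \<open>algebra_simps\<close>\<close>

section \<open>Products and classes of ideals, computed on generating sets\<close>

lemma ideal_span_times_mono:
  fixes S T U :: "'r::comm_ring_1 set"
  assumes "S \<subseteq> ideal.span T"
  shows "S * U \<subseteq> ideal.span (T * U)"
proof
  fix z assume "z \<in> S * U"
  then obtain s u where z: "z = s * u" and s: "s \<in> S" and u: "u \<in> U"
    by (auto simp: set_times_def)
  from s assms have "s \<in> ideal.span T" by blast
  then have "s * u \<in> ideal.span (T * U)"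
  proof (induction rule: ideal.span_induct_alt)
    case base
    then show ?case using ideal.span_zero[of "T * U"] by simp
  next
    case (step c x y)
    have "x * u \<in> ideal.span (T * U)"
      using step(1) u by (auto simp: set_times_def intro!: ideal.span_base)
    then have "c * (x * u) \<in> ideal.span (T * U)" by (rule ideal.span_scale)
    from ideal.span_add[OF this step(2)] show ?case by (simp add: algebra_simps)
  qed
  then show "z \<in> ideal.span (T * U)" by (simp add: z)
qed

text \<open>Makes the product of ideals well defined on generating sets: \<open>S * U\<close> is the
  set of pairwise products, and its span depends on \<open>S\<close> only through the ideal of
  \<open>S\<close>.\<close>

lemma ideal_span_times_cong:
  fixes S T U :: "'r::comm_ring_1 set"
  assumes "ideal.span S = ideal.span T"
  shows "ideal.span (S * U) = ideal.span (T * U)"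
proof -
  have "S \<subseteq> ideal.span T" "T \<subseteq> ideal.span S"
    using assms ideal.span_superset by blast+
  then show ?thesis
    by (simp add: ideal_span_times_mono ideal.span_eq)
qed

text \<open>Ideals are compared up to nonzero principal factors on both sides, which stays inside
  the ring: neither fractions nor a quotient by classes is formed.\<close>

definition ideal_class_eq :: "'r::comm_ring_1 set \<Rightarrow> 'r set \<Rightarrow> bool" (infix "\<approx>" 50)
  where "S \<approx> T \<longleftrightarrow> (\<exists>a b. a \<noteq> 0 \<and> b \<noteq> 0 \<and> ideal.span ({a} * S) = ideal.span ({b} * T))"

lemma ideal_class_eq_refl [simp]: "S \<approx> S"
  unfolding ideal_class_eq_def using one_neq_zero by blast

lemma ideal_class_eq_sym: "S \<approx> T \<Longrightarrow> T \<approx> S"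
  unfolding ideal_class_eq_def by metis

lemma times_singletons: "{a} * {b} = {a * b}"
  by (auto simp: set_times_def)

text \<open>Scaling the first equation by \<open>c\<close> and the second by \<open>b\<close> makes
  the middle ideals agree; in an integral domain the factors stay nonzero.\<close>

lemma ideal_class_eq_trans [trans]:
  fixes S T U :: "'r::idom set"
  assumes "S \<approx> T" "T \<approx> U"
  shows "S \<approx> U"
proof -
  obtain a b c d where nz: "a \<noteq> 0" "b \<noteq> 0" "c \<noteq> 0" "d \<noteq> 0"
    and 1: "ideal.span ({a} * S) = ideal.span ({b} * T)"
    and 2: "ideal.span ({c} * T) = ideal.span ({d} * U)"
    using assms unfolding ideal_class_eq_def by blast
  have "ideal.span ({c * a} * S) = ideal.span (({a} * S) * {c})"
    by (simp add: ac_simps flip: times_singletons)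
  also have "\<dots> = ideal.span (({b} * T) * {c})" by (rule ideal_span_times_cong[OF 1])
  also have "\<dots> = ideal.span (({c} * T) * {b})" by (simp add: ac_simps)
  also have "\<dots> = ideal.span (({d} * U) * {b})" by (rule ideal_span_times_cong[OF 2])
  also have "\<dots> = ideal.span ({d * b} * U)"
    by (simp add: ac_simps flip: times_singletons)
  finally show ?thesis using nz unfolding ideal_class_eq_def by (metis no_zero_divisors)
qed

lemma ideal_class_eq_mult:
  assumes "S \<approx> T"
  shows "S * U \<approx> T * U"
  using assms unfolding ideal_class_eq_def by (metis ideal_span_times_cong mult.assoc)

lemma ideal_class_eq_mult_left:
  assumes "S \<approx> T"
  shows "U * S \<approx> U * T"
  using ideal_class_eq_mult[OF assms] by (simp add: mult.commute[of U])

section \<open>The coordinate ring and its norm down to polynomials in X\<close>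

declare [[typedef_overloaded]]

text \<open>\<open>Coord u v\<close> stands for \<open>u + v Y\<close> modulo \<open>Y\<^sup>2 = X\<^sup>3 - X\<close>.\<close>

datatype 'a coord = Coord (cre: "'a poly") (cim: "'a poly")

definition cubic :: "'a::comm_ring_1 poly" where "cubic = [:0, -1, 0, 1:]"

instantiation coord :: (comm_ring_1) comm_ring_1
begin
definition "0 = Coord 0 0"
definition "1 = Coord 1 0"
definition "z + w = Coord (cre z + cre w) (cim z + cim w)"
definition "z - w = Coord (cre z - cre w) (cim z - cim w)"
definition "- z = Coord (- cre z) (- cim z)"
definition "z * w =
  Coord (cre z * cre w + cubic * cim z * cim w) (cre z * cim w + cim z * cre w)"
instance
  by standard
    (simp_all add: zero_coord_def one_coord_def plus_coord_def minus_coord_def uminus_coord_def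
      times_coord_def algebra_simps)
end

lemmas coord_defs = zero_coord_def one_coord_def plus_coord_def minus_coord_def uminus_coord_def
      times_coord_def

text \<open>The product of \<open>u + v Y\<close> and its conjugate \<open>u - v Y\<close>.\<close>

definition cnorm :: "'a::comm_ring_1 coord \<Rightarrow> 'a poly"
  where "cnorm z = cre z ^ 2 - cubic * cim z ^ 2"

lemma cnorm_mult: "cnorm (z * w) = cnorm z * cnorm w"
  unfolding cnorm_def times_coord_def by (simp add: algebra_simps power2_eq_square)

lemma degree_cubic: "Polynomial.degree (cubic :: 'a::comm_ring_1 poly) = 3"
  by (simp add: cubic_def)

lemma cubic_nonzero: "(cubic :: 'a::comm_ring_1 poly) \<noteq> 0"
  by (simp add: cubic_def)

text \<open>The square \<open>u ^ 2\<close> has even degree and \<open>cubic * v ^ 2\<close> odd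
  degree at least 3, so the leading terms cannot cancel.\<close>

lemma cnorm_degree_ge_2:
  fixes z :: "'a::field coord"
  assumes "cim z \<noteq> 0"
  shows "Polynomial.degree (cnorm z) \<ge> 2"
proof -
  let ?u = "cre z ^ 2" and ?v = "cubic * cim z ^ 2"
  have v: "Polynomial.degree ?v = 3 + 2 * Polynomial.degree (cim z)"
    using assms by (simp add: degree_mult_eq degree_power_eq degree_cubic cubic_nonzero)
  have u: "Polynomial.degree ?u = 2 * Polynomial.degree (cre z)"
    by (cases "cre z = 0") (simp_all add: degree_power_eq)
  have "Polynomial.degree ?u \<noteq> Polynomial.degree ?v" unfolding u v by presburger
  then consider "Polynomial.degree ?u < Polynomial.degree ?v" | "Polynomial.degree ?v < Polynomial.degree ?u"
    by linarith
  then show ?thesis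
  proof cases
    case 1
    then have "Polynomial.degree (?u + - ?v) = Polynomial.degree (- ?v)"
      by (intro degree_add_eq_right) simp
    then show ?thesis using v by (simp add: cnorm_def)
  next
    case 2
    then have "Polynomial.degree (?u + - ?v) = Polynomial.degree ?u"
      by (intro degree_add_eq_left) simp
    then show ?thesis using v 2 by (simp add: cnorm_def)
  qed
qed

lemma cnorm_eq_0_iff: "cnorm z = 0 \<longleftrightarrow> z = (0 :: 'a::field coord)"
proof
  assume *: "cnorm z = 0"
  then have "cim z = 0" using cnorm_degree_ge_2[of z] by force
  with * show "z = 0" by (cases z) (simp add: cnorm_def zero_coord_def)
qed (simp add: cnorm_def zero_coord_def)

instance coord :: (field) idom
proof
  fix z w :: "'a coord" assume "z \<noteq> 0" "w \<noteq> 0"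
  then show "z * w \<noteq> 0" by (simp add: cnorm_mult flip: cnorm_eq_0_iff)
qed

text \<open>A Y-part would force a norm of degree at least 2. Without one the norm is the square of
  a polynomial, so that polynomial is a nonzero constant.\<close>

lemma cnorm_degree_le_1:
  fixes z :: "'a::field coord"
  assumes "z \<noteq> 0" "Polynomial.degree (cnorm z) \<le> 1"
  obtains c where "c * z = 1"
proof -
  have im: "cim z = 0" using assms(2) cnorm_degree_ge_2[of z] by linarith
  then have re: "cre z \<noteq> 0" using assms(1) by (cases z) (auto simp: zero_coord_def)
  have "Polynomial.degree (cre z) = 0"
    using assms(2) re by (simp add: cnorm_def im degree_power_eq)
  then obtain a where a: "cre z = [:a:]" by (meson degree_eq_zeroE)
  with re have "Coord [:inverse a:] 0 * z = 1"
    by (simp add: times_coord_def one_coord_def im one_pCons)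
  then show thesis by (rule that)
qed

section \<open>Points as ideals\<close>

definition ceval :: "'a::comm_ring_1 \<Rightarrow> 'a \<Rightarrow> 'a coord \<Rightarrow> 'a"
  where "ceval a b z = poly (cre z) a + b * poly (cim z) a"

lemma ceval_add: "ceval a b (z + w) = ceval a b z + ceval a b w"
  by (simp add: ceval_def plus_coord_def algebra_simps)

lemma ceval_mult:
  assumes "b ^ 2 = a ^ 3 - a"
  shows "ceval a b (z * w) = ceval a b z * ceval a b w"
proof -
  have "poly cubic a = b * b"
    using assms by (simp add: cubic_def algebra_simps power2_eq_square power3_eq_cube)
  then show ?thesis
    by (simp add: ceval_def times_coord_def algebra_simps)
qed

definition const :: "'a::comm_ring_1 \<Rightarrow> 'a coord" where "const c = Coord [:c:] 0"
definition coordX :: "'a::comm_ring_1 coord" where "coordX = Coord [:0, 1:] 0"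
definition coordY :: "'a::comm_ring_1 coord" where "coordY = Coord 0 1"

lemma const_simps:
  "const (a + b) = const a + const b" "const (a - b) = const a - const b"
  "const (- a) = - const a" "const (a * b) = const a * const b" "const 0 = 0" "const 1 = 1"
  by (simp_all add: const_def coord_defs one_pCons)

lemma const_power: "const (a ^ n) = const a ^ n"
  by (induction n) (simp_all add: const_simps)

lemma coord_curve: "coordY ^ 2 = coordX ^ 3 - (coordX :: 'a::comm_ring_1 coord)"
  by (simp add: coordX_def coordY_def power2_eq_square power3_eq_cube coord_defs cubic_def)

text \<open>For a point of the curve this generates the ideal of functions vanishing there; infinity
  gets the unit ideal, which makes it neutral.\<close>

fun gens :: "'a::comm_ring_1 ec_point \<Rightarrow> 'a coord set" where
  "gens Infinity = {1}"
| "gens (Point a b) = {coordX - const a, coordY - const b}"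

text \<open>If \<open>g\<close> generates the ideal of an affine point, the norm of
  \<open>X - a\<close>, of degree 2, is the product of the norms of \<open>g\<close> and of a
  cofactor. So one of these two is a unit, and neither can be.\<close>

lemma principal_imp_Infinity:
  fixes P :: "'a::field ec_point"
  assumes "gens P \<approx> {1}"
    and on: "\<And>a b. P = Point a b \<Longrightarrow> b ^ 2 = a ^ 3 - a"
  shows "P = Infinity"
proof (cases P)
  case (Point a b)
  let ?x = "coordX - const a" and ?y = "coordY - const b"
  obtain c d where cd: "c \<noteq> 0" "d \<noteq> 0"
    and eq: "ideal.span ({c} * gens P) = ideal.span ({d} * {1})"
    using assms(1) unfolding ideal_class_eq_def by blast
  have "{c} * gens P = {c * ?x, c * ?y}" by (auto simp: Point set_times_def)
  with eq have eq: "ideal.span {c * ?x, c * ?y} = range (\<lambda>k. k * d)"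
    by (simp add: times_singletons ideal.span_singleton)
  obtain h1 where h1: "c * ?x = h1 * d"
    using eq ideal.span_base[of "c * ?x" "{c * ?x, c * ?y}"] by auto
  obtain h2 where h2: "c * ?y = h2 * d"
    using eq ideal.span_base[of "c * ?y" "{c * ?x, c * ?y}"] by auto
  have "d \<in> ideal.span {c * ?x, c * ?y}" unfolding eq by (auto intro: range_eqI[of _ _ 1])
  then obtain r s where rs: "d = r * (c * ?x) + s * (c * ?y)"
    by (auto simp: ideal.span_insert ideal.span_singleton algebra_simps)
  \<comment> \<open>Cancelling \<open>c\<close> from \<open>d\<close> leaves a generator of the
    ideal of the point itself.\<close>
  define g where "g = r * ?x + s * ?y"
  have d: "d = c * g" unfolding rs g_def by (simp add: algebra_simps)
  with cd have "g \<noteq> 0" by auto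
  have x: "?x = h1 * g" and y: "?y = h2 * g"
    using h1 h2 cd unfolding d by (simp_all add: mult.left_commute)
  have "Polynomial.degree (cnorm ?x) = 2"
    by (simp add: cnorm_def const_def coordX_def coord_defs degree_power_eq)
  then have nz: "cnorm ?x \<noteq> 0" by force
  then have "h1 \<noteq> 0" unfolding x by (auto simp: cnorm_eq_0_iff)
  have "Polynomial.degree (cnorm h1) + Polynomial.degree (cnorm g) = 2"
    using \<open>Polynomial.degree (cnorm ?x) = 2\<close> nz unfolding x cnorm_mult
    by (simp add: degree_mult_eq)
  then consider "Polynomial.degree (cnorm h1) \<le> 1" | "Polynomial.degree (cnorm g) \<le> 1" by linarith
  then show ?thesis
  proof cases
    case 1
    \<comment> \<open>The cofactor is a unit: then \<open>X - a\<close> divides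
      \<open>Y - b\<close>, and the Y-coefficient 1 would vanish at \<open>a\<close>.\<close>
    then obtain u where "u * h1 = 1" using cnorm_degree_le_1[OF \<open>h1 \<noteq> 0\<close>] by blast
    then have "g = u * ?x" unfolding x by (simp flip: mult.assoc)
    then have "?y = (h2 * u) * ?x" using y by (simp add: mult.assoc)
    then have "cim ?y = cim (h2 * u) * cre ?x"
      by (simp add: times_coord_def minus_coord_def coordX_def const_def)
    then have "1 = cim (h2 * u) * [:-a, 1:]"
      by (simp add: minus_coord_def coordX_def coordY_def const_def)
    then have "poly 1 a = poly (cim (h2 * u) * [:-a, 1:]) a" by simp
    then show ?thesis by simp
  next
    case 2
    \<comment> \<open>The generator is a unit: but it vanishes at the point, and evaluation there is
      multiplicative.\<close>
    then obtain u where u: "u * g = 1" using cnorm_degree_le_1[OF \<open>g \<noteq> 0\<close>] by blast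
    have ev: "ceval a b (z * w) = ceval a b z * ceval a b w" for z w
      by (rule ceval_mult) (use on Point in blast)
    have "ceval a b g = 0" unfolding g_def
      by (simp add: ev ceval_add) (simp add: ceval_def minus_coord_def coordX_def coordY_def const_def)
    then have "ceval a b (u * g) = 0" by (simp add: ev)
    then show ?thesis by (simp add: u) (simp add: ceval_def one_coord_def)
  qed
qed simp

section \<open>The group law\<close>

lemma times_pairs: "{a, b} * {c, d} = {a * c, a * d, b * c, b * d}"
  by (auto simp: set_times_def)

lemma times_triple_singleton: "{a, b, c, d} * {e} = {a * e, b * e, c * e, d * e}"
  by (auto simp: set_times_def)

text \<open>A point and its reflection lie on the vertical line \<open>X = A\<close>. The product
  ideal contains \<open>e * (X - A)\<close> and \<open>2 * N * (X - A)\<close>. In the application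
  \<open>e\<close> is the derivative of the cubic at \<open>A\<close>, and smoothness of the curve
  makes \<open>e\<close> or \<open>2 * N\<close> a unit.\<close>

lemma ideal_span_opposite:
  fixes X Y A N G :: "'r::comm_ring_1"
  assumes curve: "(Y - N) * (Y + N) = (X - A) * ((X - A) * G + e)"
    and unit: "u * e = 1 \<or> u * (2 * N) = 1"
  shows "ideal.span ({X - A, Y - N} * {X - A, Y + N}) = ideal.span {X - A}"
proof -
  let ?S = "{X - A, Y - N} * {X - A, Y + N}"
  have S: "?S = {(X - A) * (X - A), (X - A) * (Y + N), (Y - N) * (X - A), (Y - N) * (Y + N)}"
    by (rule times_pairs)
  have span: "(X - A) * r \<in> ideal.span {X - A}" for r
    using ideal.span_scale[OF ideal.span_base, of "X - A" "{X - A}" r] by (simp add: mult.commute)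
  have "?S \<subseteq> ideal.span {X - A}"
    unfolding S curve
    using span[of "X - A"] span[of "Y + N"] span[of "Y - N"] span[of "(X - A) * G + e"]
    by (simp add: mult.commute[of "Y - N"])
  moreover have "X - A \<in> ideal.span ?S"
  proof -
    have mem: "(X - A) * (X - A) \<in> ideal.span ?S" "(X - A) * (Y + N) \<in> ideal.span ?S"
      "(Y - N) * (X - A) \<in> ideal.span ?S" "(Y - N) * (Y + N) \<in> ideal.span ?S"
      unfolding S by (auto intro: ideal.span_base)
    have "(Y - N) * (Y + N) - G * ((X - A) * (X - A)) = e * (X - A)"
      unfolding curve by (simp add: algebra_simps)
    with mem have 1: "e * (X - A) \<in> ideal.span ?S"
      by (metis ideal.span_diff ideal.span_scale)
    have "(X - A) * (Y + N) - (Y - N) * (X - A) = 2 * N * (X - A)" by (simp add: algebra_simps)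
    with mem have 2: "2 * N * (X - A) \<in> ideal.span ?S"
      by (metis ideal.span_diff)
    from unit show ?thesis
    proof
      assume "u * e = 1"
      with ideal.span_scale[OF 1, of u] show ?thesis by (simp flip: mult.assoc)
    next
      assume "u * (2 * N) = 1"
      with ideal.span_scale[OF 2, of u] show ?thesis by (simp flip: mult.assoc)
    qed
  qed
  ultimately show ?thesis by (simp add: ideal.span_eq)
qed

text \<open>The ideals of the three intersection points with a line multiply to the ideal of the
  line. Multiplying by the ideal of the reflected third point turns the third factor into
  \<open>X - C\<close>. The unit is the difference of the abscissas for a chord, twice the ordinate
  for a tangent.\<close>

lemma ideal_span_chord:
  fixes X Y A B C L N :: "'r::comm_ring_1"
  assumes curve: "(Y - L * X - N) * (Y + L * X + N) = (X - A) * (X - B) * (X - C)"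
    and unit: "u * (A - B) = 1 \<or> A = B \<and> u * (2 * (L * A + N)) = 1"
  shows "ideal.span ({X - A, Y - (L * A + N)} * {X - B, Y - (L * B + N)} * {X - C}) =
    ideal.span ({Y - L * X - N} * {X - C, Y + (L * C + N)})"
proof -
  let ?S = "{X - A, Y - (L * A + N)} * {X - B, Y - (L * B + N)} * {X - C}"
  let ?l = "Y - L * X - N" and ?m = "Y + (L * C + N)"
  let ?T = "{?l} * {X - C, ?m}"
  have S: "?S = {(X - A) * (X - B) * (X - C), (X - A) * (Y - (L * B + N)) * (X - C),
       (Y - (L * A + N)) * (X - B) * (X - C), (Y - (L * A + N)) * (Y - (L * B + N)) * (X - C)}"
    unfolding times_pairs times_triple_singleton by simp
  have T: "?T = {?l * (X - C), ?l * ?m}"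
    by (auto simp: set_times_def)
  have inT: "r * (?l * (X - C)) + s * (?l * ?m) \<in> ideal.span ?T" for r s
    unfolding T by (intro ideal.span_add ideal.span_scale ideal.span_base) auto
  have "(X - A) * (X - B) * (X - C) \<in> ideal.span ?T"
    unfolding curve[symmetric] using inT[of L 1] by (simp add: algebra_simps)
  moreover have "(X - A) * (Y - (L * B + N)) * (X - C) \<in> ideal.span ?T"
  proof -
    \<comment> \<open>Write \<open>Y - (L * B + N)\<close> as \<open>?l + L * (X - B)\<close> and
      use \<open>Y + L * X + N = ?m + L * (X - C)\<close> in the curve equation. The next two
      generators go the same way.\<close>
    have "(X - A) * (Y - (L * B + N)) * (X - C) =
        (X - A) * ?l * (X - C) + L * ((X - A) * (X - B) * (X - C))"
      by (simp add: algebra_simps)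
    also have "\<dots> = (X - A + L * L) * (?l * (X - C)) + L * (?l * ?m)"
      unfolding curve[symmetric] by (simp add: algebra_simps)
    finally show ?thesis by (simp only: inT)
  qed
  moreover have "(Y - (L * A + N)) * (X - B) * (X - C) \<in> ideal.span ?T"
  proof -
    have "(Y - (L * A + N)) * (X - B) * (X - C) =
        (X - B) * ?l * (X - C) + L * ((X - A) * (X - B) * (X - C))"
      by (simp add: algebra_simps)
    also have "\<dots> = (X - B + L * L) * (?l * (X - C)) + L * (?l * ?m)"
      unfolding curve[symmetric] by (simp add: algebra_simps)
    finally show ?thesis by (simp only: inT)
  qed
  moreover have "(Y - (L * A + N)) * (Y - (L * B + N)) * (X - C) \<in> ideal.span ?T"
  proof -
    have "(Y - (L * A + N)) * (Y - (L * B + N)) * (X - C) =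
        (?l + L * (X - A) + L * (X - B)) * (?l * (X - C)) + L * L * ((X - A) * (X - B) * (X - C))"
      by (simp add: algebra_simps)
    also have "\<dots> = (?l + L * (X - A) + L * (X - B) + L * L * L) * (?l * (X - C)) + L * L * (?l * ?m)"
      unfolding curve[symmetric] by (simp add: algebra_simps)
    finally show ?thesis by (simp only: inT)
  qed
  ultimately have "?S \<subseteq> ideal.span ?T"
    unfolding S by blast
  moreover have "?T \<subseteq> ideal.span ?S"
  proof -
    define J where "J = ideal.span ?S"
    have J: "x \<in> J \<Longrightarrow> r * x \<in> J" "x \<in> J \<Longrightarrow> y \<in> J \<Longrightarrow> x + y \<in> J"
      "x \<in> J \<Longrightarrow> y \<in> J \<Longrightarrow> x - y \<in> J" for x y r
      unfolding J_def by (auto intro: ideal.span_scale ideal.span_add ideal.span_diff)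
    have p1: "(X - A) * (X - B) * (X - C) \<in> J" and p2: "(X - A) * (Y - (L * B + N)) * (X - C) \<in> J"
      and p3: "(Y - (L * A + N)) * (X - B) * (X - C) \<in> J"
      and p4: "(Y - (L * A + N)) * (Y - (L * B + N)) * (X - C) \<in> J"
      unfolding J_def S by (auto intro: ideal.span_base)
    have "(X - A) * (Y - (L * B + N)) * (X - C) - L * ((X - A) * (X - B) * (X - C))
        = (X - A) * (?l * (X - C))" by (simp add: algebra_simps)
    with p1 p2 have q2: "(X - A) * (?l * (X - C)) \<in> J" by (metis J(1) J(3))
    have "(Y - (L * A + N)) * (X - B) * (X - C) - L * ((X - A) * (X - B) * (X - C))
        = (X - B) * (?l * (X - C))" by (simp add: algebra_simps)
    with p1 p3 have q3: "(X - B) * (?l * (X - C)) \<in> J" by (metis J(1) J(3))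
    have l: "?l * (X - C) \<in> J"
      using unit
    proof
      assume u: "u * (A - B) = 1"
      have "u * ((X - B) * (?l * (X - C)) - (X - A) * (?l * (X - C))) = u * (A - B) * (?l * (X - C))"
        by (simp add: algebra_simps)
      then show ?thesis using u J(1)[OF J(3)[OF q3 q2], of u] by simp
    next
      assume u: "A = B \<and> u * (2 * (L * A + N)) = 1"
      \<comment> \<open>Tangent case: \<open>J\<close> contains \<open>?l * (X - C)\<close> times
        each of \<open>?l\<close>, \<open>X - A\<close> and \<open>Y + L * X + N\<close>, and
        \<open>2 * (L * A + N)\<close> is the last of these minus \<open>?l\<close> minus
        \<open>2 * L * (X - A)\<close>.\<close>
      have "(Y - (L * A + N)) * (Y - (L * B + N)) * (X - C) -
          (L * ((X - A) * (?l * (X - C))) + (L * ((X - B) * (?l * (X - C))) + L * L * ((X - A) * (X - B) * (X - C))))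
          = ?l * (?l * (X - C))" by (simp add: algebra_simps)
      moreover have "\<dots> \<in> J"
        unfolding calculation[symmetric] by (intro J p4 q2 q3 p1)
      ultimately have q4: "?l * (?l * (X - C)) \<in> J" by simp
      have q1: "(X - C) * (?l * (Y + L * X + N)) \<in> J" unfolding curve by (intro J p1)
      have "u * ((X - C) * (?l * (Y + L * X + N)) - ?l * (?l * (X - C)) - 2 * L * ((X - A) * (?l * (X - C)))) \<in> J"
        by (rule J(1)[OF J(3)[OF J(3)[OF q1 q4] J(1)[OF q2]]])
      moreover have "u * ((X - C) * (?l * (Y + L * X + N)) - ?l * (?l * (X - C)) - 2 * L * ((X - A) * (?l * (X - C))))
         = u * (2 * (L * A + N)) * (?l * (X - C))"
        by (simp add: algebra_simps)
      ultimately have "u * (2 * (L * A + N)) * (?l * (X - C)) \<in> J" by (simp only:)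
      then show ?thesis using u[THEN conjunct2] by (simp only: mult_1)
    qed
    have "?l * ?m = (X - A) * (X - B) * (X - C) - L * (?l * (X - C))"
      unfolding curve[symmetric] by (simp add: algebra_simps)
    moreover have "\<dots> \<in> J" by (intro J p1 l)
    ultimately have "?l * ?m \<in> J" by simp
    with l show ?thesis unfolding T J_def by blast
  qed
  ultimately show ?thesis by (simp add: ideal.span_eq)
qed

section \<open>The chord-tangent law on y^2 = x^3 - x\<close>

definition curve :: "'a::field ec_point set"
  where "curve = insert Infinity {Point x y | x y. y ^ 2 = x ^ 3 - x}"

lemma Infinity_in_curve [simp]: "Infinity \<in> curve"
  and Point_in_curve [simp]: "Point x y \<in> curve \<longleftrightarrow> y ^ 2 = x ^ 3 - x"
  by (auto simp: curve_def)

definition chord_slope :: "'a::field \<Rightarrow> 'a \<Rightarrow> 'a \<Rightarrow> 'a \<Rightarrow> 'a"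
  where "chord_slope x1 y1 x2 y2 =
    (if x1 = x2 then (3 * x1 ^ 2 - 1) / (2 * y1) else (y2 - y1) / (x2 - x1))"

fun curve_add :: "'a::field ec_point \<Rightarrow> 'a ec_point \<Rightarrow> 'a ec_point" where
  "curve_add Infinity Q = Q"
| "curve_add (Point x1 y1) Infinity = Point x1 y1"
| "curve_add (Point x1 y1) (Point x2 y2) =
     (if x1 = x2 \<and> y2 = - y1 then Infinity
      else let l = chord_slope x1 y1 x2 y2; x3 = l ^ 2 - x1 - x2
           in Point x3 (l * (x1 - x3) - y1))"

fun curve_neg :: "'a::field ec_point \<Rightarrow> 'a ec_point" where
  "curve_neg Infinity = Infinity"
| "curve_neg (Point x y) = Point x (- y)"

lemma curve_neg_in_curve [simp]: "curve_neg P \<in> curve \<longleftrightarrow> P \<in> curve"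
  by (cases P) simp_all

text \<open>Vieta's formulas: substituting the line \<open>y = l x + n\<close> turns the curve
  equation into a cubic in x with roots \<open>x1\<close>, \<open>x2\<close>, \<open>x3\<close>; the
  choice of \<open>x3\<close> is the formula for the sum of the roots.\<close>

lemma chord_relations:
  fixes x1 y1 x2 y2 :: "'a::field"
  assumes two: "(2::'a) \<noteq> 0"
    and P: "y1 ^ 2 = x1 ^ 3 - x1" and Q: "y2 ^ 2 = x2 ^ 3 - x2"
    and ne: "\<not> (x1 = x2 \<and> y2 = - y1)"
    and l: "l = chord_slope x1 y1 x2 y2" and n: "n = y1 - l * x1" and x3: "x3 = l ^ 2 - x1 - x2"
  shows "y1 = l * x1 + n" "y2 = l * x2 + n" "x1 = x2 \<Longrightarrow> y1 \<noteq> 0"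
    "- 1 - 2 * l * n = x1 * x2 + (x1 + x2) * x3" "n ^ 2 = x1 * x2 * x3"
proof -
  show y1: "y1 = l * x1 + n" by (simp add: n)
  have same: "y1 = y2 \<and> y1 \<noteq> 0" if "x1 = x2"
  proof -
    have "(y2 - y1) * (y2 + y1) = y2 ^ 2 - y1 ^ 2" by (simp add: algebra_simps power2_eq_square)
    also have "\<dots> = 0" using P Q that by simp
    finally have "(y2 - y1) * (y2 + y1) = 0" .
    moreover have "y2 + y1 \<noteq> 0" using ne that by (auto simp: add_eq_0_iff2)
    ultimately show ?thesis using two by auto
  qed
  then show "x1 = x2 \<Longrightarrow> y1 \<noteq> 0" by blast
  show y2: "y2 = l * x2 + n"
  proof (cases "x1 = x2")
    case True
    then show ?thesis using same by (simp add: n)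
  next
    case False
    then have "l * (x2 - x1) = y2 - y1" by (simp add: l chord_slope_def)
    then show ?thesis by (simp add: n algebra_simps)
  qed
  show e1: "- 1 - 2 * l * n = x1 * x2 + (x1 + x2) * x3"
  proof (cases "x1 = x2")
    case True
    then have "y1 \<noteq> 0" using same by blast
    then have "2 * l * y1 = 3 * x1 ^ 2 - 1" using True two by (simp add: l chord_slope_def)
    then show ?thesis unfolding n x3 True by (simp add: algebra_simps power2_eq_square)
  next
    case False
    \<comment> \<open>Subtract the curve equations at the two points of the line, then divide by
      \<open>x1 - x2\<close>.\<close>
    have "(x1 - x2) * (- 1 - 2 * l * n - x1 * x2 - (x1 + x2) * x3) =
       (x1 ^ 3 - x1 - (l * x1 + n) ^ 2) - (x2 ^ 3 - x2 - (l * x2 + n) ^ 2)"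
      unfolding x3 by (simp add: algebra_simps power2_eq_square power3_eq_cube)
    also have "\<dots> = 0" using P Q by (simp flip: y1 y2)
    finally have "- 1 - 2 * l * n - x1 * x2 - (x1 + x2) * x3 = 0"
      using False by (simp only: mult_eq_0_iff right_minus_eq) simp
    then show ?thesis by (simp add: algebra_simps)
  qed
  have l2: "l ^ 2 = x1 + x2 + x3" by (simp add: x3)
  have "n ^ 2 = x1 ^ 3 - l ^ 2 * x1 ^ 2 + (- 1 - 2 * l * n) * x1"
    using P unfolding y1 by (simp add: algebra_simps power2_eq_square)
  also have "\<dots> = x1 * x2 * x3"
    unfolding l2 e1 by (simp add: algebra_simps power2_eq_square power3_eq_cube)
  finally show "n ^ 2 = x1 * x2 * x3" .
qed

lemma curve_add_in_curve:
  fixes P Q :: "'a::field ec_point"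
  assumes two: "(2::'a) \<noteq> 0" and "P \<in> curve" "Q \<in> curve"
  shows "curve_add P Q \<in> curve"
proof (cases "(P, Q)" rule: curve_add.cases)
  case (3 x1 y1 x2 y2)
  show ?thesis
  proof (cases "x1 = x2 \<and> y2 = - y1")
    case False
    define l where "l = chord_slope x1 y1 x2 y2"
    define n where "n = y1 - l * x1"
    define x3 where "x3 = l ^ 2 - x1 - x2"
    have on: "y1 ^ 2 = x1 ^ 3 - x1" "y2 ^ 2 = x2 ^ 3 - x2" using assms 3 by auto
    note rel = chord_relations[OF two on False l_def n_def x3_def]
    have "(l * (x1 - x3) - y1) ^ 2 = l ^ 2 * x3 ^ 2 + 2 * l * n * x3 + n ^ 2"
      unfolding n_def by (simp add: algebra_simps power2_eq_square)
    also have "2 * l * n = - 1 - (x1 * x2 + (x1 + x2) * x3)"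
      using rel(4) by (simp add: algebra_simps)
    also have "l ^ 2 = x1 + x2 + x3" by (simp add: x3_def)
    also have "(x1 + x2 + x3) * x3 ^ 2 + (- 1 - (x1 * x2 + (x1 + x2) * x3)) * x3 + n ^ 2 = x3 ^ 3 - x3"
      unfolding rel(5) by (simp add: algebra_simps power2_eq_square power3_eq_cube)
    finally have "Point x3 (l * (x1 - x3) - y1) \<in> curve" by simp
    also have "Point x3 (l * (x1 - x3) - y1) = curve_add P Q"
      using 3 False by (auto simp: l_def x3_def Let_def)
    finally show ?thesis .
  qed (use 3 in simp)
qed (use assms in auto)

lemma const_unit: "c \<noteq> 0 \<Longrightarrow> const (inverse c) * const c = (1 :: 'a::field coord)"
  by (simp flip: const_simps)

lemma const_2: "const 2 = 2"
  using const_simps(1)[of 1 1] by (simp add: const_simps(6))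

lemma const_3: "const 3 = 3"
  using const_simps(1)[of 2 1] by (simp add: const_simps(6) const_2)

text \<open>For opposite points the product is the principal ideal of a vertical line. Otherwise the
  chord identity links product and sum through the factors \<open>X - x3\<close> and the
  line.\<close>

lemma gens_mult:
  fixes P Q :: "'a::field ec_point"
  assumes two: "(2::'a) \<noteq> 0" and "P \<in> curve" "Q \<in> curve"
  shows "gens P * gens Q \<approx> gens (curve_add P Q)"
proof (cases "(P, Q)" rule: curve_add.cases)
  case (1 Q')
  then show ?thesis by (simp flip: set_one)
next
  case (2 a b)
  then show ?thesis by (simp del: set_one flip: set_one)
next
  case (3 x1 y1 x2 y2)
  have on: "y1 ^ 2 = x1 ^ 3 - x1" "y2 ^ 2 = x2 ^ 3 - x2" using assms 3 by auto
  have nz: "coordX - const a \<noteq> 0" for a :: 'a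
    by (simp add: coordX_def const_def coord_defs)
  show ?thesis
  proof (cases "x1 = x2 \<and> y2 = - y1")
    case True
    let ?A = "const x1" and ?N = "const y1"
    have "(coordY - ?N) * (coordY + ?N) = coordX ^ 3 - coordX - const (x1 ^ 3 - x1)"
      unfolding on(1)[symmetric] const_power coord_curve[symmetric]
      by (simp add: algebra_simps power2_eq_square)
    also have "\<dots> = (coordX - ?A) * ((coordX - ?A) * (coordX + 2 * ?A) + const (3 * x1 ^ 2 - 1))"
      by (simp add: const_simps const_power const_3 algebra_simps power2_eq_square power3_eq_cube)
    finally have c: "(coordY - ?N) * (coordY + ?N) = \<dots>" .
    \<comment> \<open>Nonsingularity: at a common zero, \<open>x1 = 3 * x1 ^ 3 = 3 * x1\<close>, so
      \<open>x1 = 0\<close>, against \<open>3 * x1 ^ 2 = 1\<close>.\<close>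
    have "3 * x1 ^ 2 - 1 \<noteq> 0 \<or> y1 \<noteq> 0"
    proof (rule ccontr)
      assume "\<not> ?thesis"
      then have *: "3 * x1 ^ 2 = 1" "x1 ^ 3 = x1" using on(1) by auto
      have "x1 * (3 * x1 ^ 2) = 3 * x1 ^ 3" by (simp add: power2_eq_square power3_eq_cube)
      then have "x1 = 3 * x1" unfolding * by simp
      then have "3 * x1 - x1 = 0" by (metis right_minus_eq)
      then have "2 * x1 = 0" by (simp add: algebra_simps)
      then show False using two * by simp
    qed
    then obtain u where "u * const (3 * x1 ^ 2 - 1) = 1 \<or> u * (2 * ?N) = 1"
    proof
      assume "y1 \<noteq> 0"
      then have "2 * y1 \<noteq> 0" using two by simp
      from const_unit[OF this] have "const (inverse (2 * y1)) * (2 * ?N) = 1"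
        by (simp only: const_simps(4) const_2)
      then show ?thesis using that by blast
    qed (use const_unit that in blast)
    from ideal_span_opposite[OF c this]
    have "ideal.span ({1} * (gens P * gens Q)) = ideal.span ({coordX - ?A} * {1})"
      using 3 True by (simp add: const_simps times_singletons flip: set_one)
    moreover have "gens (curve_add P Q) = {1}" using 3 True by simp
    ultimately show ?thesis
      unfolding ideal_class_eq_def using nz[of x1] by (intro exI[of _ 1] exI[of _ "coordX - ?A"]) simp
  next
    case False
    define l where "l = chord_slope x1 y1 x2 y2"
    define n where "n = y1 - l * x1"
    define x3 where "x3 = l ^ 2 - x1 - x2"
    note rel = chord_relations[OF two on False l_def n_def x3_def]
    let ?A = "const x1" and ?B = "const x2" and ?C = "const x3" and ?L = "const l" and ?N = "const n"
    let ?l = "coordY - ?L * coordX - ?N"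
    have "?l * (coordY + ?L * coordX + ?N) = coordX ^ 3 - coordX - (?L * coordX + ?N) ^ 2"
      unfolding coord_curve[symmetric] by (simp add: algebra_simps power2_eq_square)
    also have "\<dots> = coordX ^ 3 - const (l ^ 2) * coordX ^ 2 + const (- 1 - 2 * l * n) * coordX - const (n ^ 2)"
      by (simp add: const_simps const_power const_2 algebra_simps power2_eq_square)
    also have "l ^ 2 = x1 + x2 + x3" by (simp add: x3_def)
    also have "coordX ^ 3 - const (x1 + x2 + x3) * coordX ^ 2 + const (- 1 - 2 * l * n) * coordX - const (n ^ 2)
       = (coordX - ?A) * (coordX - ?B) * (coordX - ?C)"
      unfolding rel(4,5)
      by (simp add: const_simps const_power algebra_simps power2_eq_square power3_eq_cube)
    finally have c: "?l * (coordY + ?L * coordX + ?N) = \<dots>" .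
    have Y: "?L * ?A + ?N = const y1" "?L * ?B + ?N = const y2"
      by (simp_all add: rel(1,2)[symmetric] flip: const_simps)
    obtain u where u: "u * (?A - ?B) = 1 \<or> ?A = ?B \<and> u * (2 * (?L * ?A + ?N)) = 1"
    proof (cases "x1 = x2")
      case True
      then have "2 * y1 \<noteq> 0" using rel(3) two by simp
      from const_unit[OF this]
      have "const (inverse (2 * y1)) * (2 * (?L * ?A + ?N)) = 1"
        unfolding Y by (simp only: const_simps(4) const_2)
      then show ?thesis using True that by blast
    next
      case False
      then have "const (inverse (x1 - x2)) * (?A - ?B) = 1"
        using const_unit[of "x1 - x2"] by (simp add: const_simps(2))
      then show ?thesis using that by blast
    qed
    have "l * (x1 - x3) - y1 = - (l * x3 + n)" unfolding n_def by (simp add: algebra_simps)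
    moreover have "curve_add P Q = Point x3 (l * (x1 - x3) - y1)"
      using 3 False by (auto simp: l_def x3_def Let_def)
    ultimately have add: "curve_add P Q = Point x3 (- (l * x3 + n))" by simp
    have gens_add: "gens (curve_add P Q) = {coordX - ?C, coordY + (?L * ?C + ?N)}"
      by (simp add: add const_simps algebra_simps)
    have "?l \<noteq> 0" by (simp add: coordX_def coordY_def const_def coord_defs)
    moreover have "ideal.span ({coordX - ?C} * (gens P * gens Q)) =
        ideal.span ({?l} * gens (curve_add P Q))"
      using ideal_span_chord[OF c u] 3 unfolding gens_add Y
      by (simp add: mult.commute[of "{coordX - ?C}"])
    ultimately show ?thesis unfolding ideal_class_eq_def using nz by blast
  qed
qed

text \<open>The sum of \<open>P\<close> and the opposite of \<open>Q\<close> has a principal ideal,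
  so it is \<open>Infinity\<close>. Associativity is not yet available; that \<open>P = Q\<close>
  follows is read off from the definition of \<open>curve_add\<close>.\<close>

lemma curve_eqI:
  fixes P Q :: "'a::field ec_point"
  assumes two: "(2::'a) \<noteq> 0" and P: "P \<in> curve" and Q: "Q \<in> curve" and eq: "gens P \<approx> gens Q"
  shows "P = Q"
proof -
  let ?R = "curve_add P (curve_neg Q)"
  have "gens ?R \<approx> gens P * gens (curve_neg Q)"
    using gens_mult[OF two, of P "curve_neg Q"] P Q by (simp add: ideal_class_eq_sym)
  also have "gens P * gens (curve_neg Q) \<approx> gens Q * gens (curve_neg Q)"
    by (rule ideal_class_eq_mult[OF eq])
  also have "gens Q * gens (curve_neg Q) \<approx> gens (curve_add Q (curve_neg Q))"
    using gens_mult[OF two, of Q "curve_neg Q"] Q by simp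
  also have "curve_add Q (curve_neg Q) = Infinity" by (cases Q) simp_all
  finally have "gens ?R \<approx> {1}" by simp
  moreover have "?R \<in> curve" using P Q two by (simp add: curve_add_in_curve)
  ultimately have "?R = Infinity" by (metis principal_imp_Infinity Point_in_curve)
  then show ?thesis
    by (cases P; cases Q) (auto simp: Let_def split: if_splits)
qed

definition curve_group :: "'a::field ec_point monoid"
  where "curve_group = \<lparr>carrier = curve, monoid.mult = curve_add, one = Infinity\<rparr>"

lemma curve_group_sel [simp]: "carrier curve_group = curve"
  "monoid.mult curve_group = curve_add" "one curve_group = Infinity"
  by (simp_all add: curve_group_def)

lemma comm_group_curve:
  assumes two: "(2::'a::field) \<noteq> 0"
  shows "comm_group (curve_group :: 'a ec_point monoid)"
proof (rule comm_groupI)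
  fix P Q R :: "'a ec_point"
  assume "P \<in> carrier curve_group" "Q \<in> carrier curve_group" "R \<in> carrier curve_group"
  then have c: "P \<in> curve" "Q \<in> curve" "R \<in> curve" by simp_all
  note cl = curve_add_in_curve[OF two]
  have "gens (curve_add (curve_add P Q) R) \<approx> gens (curve_add P Q) * gens R"
    using c by (intro gens_mult[THEN ideal_class_eq_sym] two cl)
  also have "gens (curve_add P Q) * gens R \<approx> gens P * gens Q * gens R"
    using c by (intro ideal_class_eq_mult gens_mult[THEN ideal_class_eq_sym] two)
  also have "gens P * gens Q * gens R = gens P * (gens Q * gens R)" by (rule mult.assoc)
  also have "\<dots> \<approx> gens P * gens (curve_add Q R)"
    using c by (intro ideal_class_eq_mult_left gens_mult two)
  also have "\<dots> \<approx> gens (curve_add P (curve_add Q R))"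
    using c by (intro gens_mult two cl)
  finally show "P \<otimes>\<^bsub>curve_group\<^esub> Q \<otimes>\<^bsub>curve_group\<^esub> R = P \<otimes>\<^bsub>curve_group\<^esub> (Q \<otimes>\<^bsub>curve_group\<^esub> R)"
    using c by (simp add: curve_eqI[OF two] cl)
next
  fix P Q :: "'a ec_point"
  assume "P \<in> carrier curve_group" "Q \<in> carrier curve_group"
  then have c: "P \<in> curve" "Q \<in> curve" by simp_all
  have "gens (curve_add P Q) \<approx> gens P * gens Q"
    using c by (intro gens_mult[THEN ideal_class_eq_sym] two)
  also have "\<dots> = gens Q * gens P" by (rule mult.commute)
  also have "\<dots> \<approx> gens (curve_add Q P)"
    using c by (intro gens_mult two)
  finally show "P \<otimes>\<^bsub>curve_group\<^esub> Q = Q \<otimes>\<^bsub>curve_group\<^esub> P"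
    using c by (simp add: curve_eqI[OF two] curve_add_in_curve[OF two])
next
  fix P :: "'a ec_point"
  assume "P \<in> carrier curve_group"
  moreover have "curve_add (curve_neg P) P = Infinity" by (cases P) simp_all
  ultimately show "\<exists>Q\<in>carrier curve_group. Q \<otimes>\<^bsub>curve_group\<^esub> P = \<one>\<^bsub>curve_group\<^esub>"
    by (intro bexI[of _ "curve_neg P"]) simp_all
qed (simp_all add: curve_add_in_curve[OF two])

section \<open>Gaussian modules of order a power of two\<close>

text \<open>Every fibre over the image is a translate of the kernel within \<open>S\<close>.\<close>

lemma (in group_hom) card_subgroup_image:
  assumes H: "subgroup S G" and fin: "finite S"
  shows "card S = card (h ` S) * card {x \<in> S. h x = \<one>\<^bsub>H\<^esub>}"
proof -
  have "card {x \<in> S. h x = y} = card {x \<in> S. h x = \<one>\<^bsub>H\<^esub>}" if "y \<in> h ` S" for y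
  proof -
    from that obtain s where s: "s \<in> S" "y = h s" by blast
    note cl = subgroup.mem_carrier[OF H] subgroup.m_closed[OF H] subgroup.m_inv_closed[OF H]
    have sc: "s \<in> carrier G" using s cl by blast
    have "bij_betw (\<lambda>x. s \<otimes> x) {x \<in> S. h x = \<one>\<^bsub>H\<^esub>} {x \<in> S. h x = y}"
    proof (rule bij_betwI[where g = "\<lambda>x. inv s \<otimes> x"])
      show "(\<lambda>x. s \<otimes> x) \<in> {x \<in> S. h x = \<one>\<^bsub>H\<^esub>} \<rightarrow> {x \<in> S. h x = y}"
        using s sc by (auto intro: cl simp: cl(1))
      show "(\<lambda>x. inv s \<otimes> x) \<in> {x \<in> S. h x = y} \<rightarrow> {x \<in> S. h x = \<one>\<^bsub>H\<^esub>}"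
        using s sc by (auto intro: cl simp: cl(1))
      show "inv s \<otimes> (s \<otimes> x) = x" if "x \<in> {x \<in> S. h x = \<one>\<^bsub>H\<^esub>}" for x
      proof -
        have "x \<in> carrier G" using that cl(1) by blast
        then show ?thesis using sc by (simp add: G.m_assoc[symmetric])
      qed
      show "s \<otimes> (inv s \<otimes> x) = x" if "x \<in> {x \<in> S. h x = y}" for x
      proof -
        have "x \<in> carrier G" using that cl(1) by blast
        then show ?thesis using sc by (simp add: G.m_assoc[symmetric])
      qed
    qed
    from bij_betw_same_card[OF this] show ?thesis by (rule sym)
  qed
  then have "(\<Sum>y\<in>h ` S. card {x \<in> S. h x = y}) = card (h ` S) * card {x \<in> S. h x = \<one>\<^bsub>H\<^esub>}"
    by simp
  moreover have "card S = (\<Sum>y\<in>h ` S. card {x \<in> S. h x = y})"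
    using sum.image_gen[OF fin, of "\<lambda>_. 1::nat" h] by simp
  ultimately show ?thesis by simp
qed

lemma (in group) int_pow_mod:
  assumes "x \<in> carrier G" "x [^] (n::int) = \<one>"
  shows "x [^] (a mod n) = x [^] (a::int)"
proof -
  have "x [^] a = x [^] (n * (a div n) + a mod n)" by simp
  also have "\<dots> = x [^] (n * (a div n)) \<otimes> x [^] (a mod n)"
    using assms by (intro int_pow_mult)
  also have "x [^] (n * (a div n)) = (x [^] n) [^] (a div n)"
    using assms by (intro int_pow_pow[symmetric])
  finally show ?thesis using assms by (simp add: int_pow_one)
qed

text \<open>The endomorphism \<open>j\<close> plays the role of multiplication by \<open>i\<close>, and \<open>\<phi>\<close> below that of \<open>1 + i\<close>.\<close>

locale gaussian_group = comm_group +
  fixes j :: "'a \<Rightarrow> 'a"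
  assumes finite_carrier: "finite (carrier G)"
    and j_hom: "j \<in> hom G G"
    and j_j: "x \<in> carrier G \<Longrightarrow> j (j x) = inv x"
    and card_fixed: "card {x \<in> carrier G. j x = inv x} = 2"
begin

definition \<phi> :: "'a \<Rightarrow> 'a" where "\<phi> x = x \<otimes> j x"

lemma j_closed [simp]: "x \<in> carrier G \<Longrightarrow> j x \<in> carrier G"
  using j_hom by (rule hom_in_carrier)

lemma j_mult: "x \<in> carrier G \<Longrightarrow> y \<in> carrier G \<Longrightarrow> j (x \<otimes> y) = j x \<otimes> j y"
  using j_hom by (rule hom_mult)

lemma phi_hom: "\<phi> \<in> hom G G"
  unfolding hom_def \<phi>_def by (auto simp: j_mult m_ac)

lemma phi_closed [simp]: "x \<in> carrier G \<Longrightarrow> \<phi> x \<in> carrier G"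
  by (simp add: \<phi>_def)

lemma phi_mult: "x \<in> carrier G \<Longrightarrow> y \<in> carrier G \<Longrightarrow> \<phi> (x \<otimes> y) = \<phi> x \<otimes> \<phi> y"
  using phi_hom by (rule hom_mult)

lemma j_eq: "x \<in> carrier G \<Longrightarrow> j x = \<phi> x \<otimes> inv x"
  by (simp add: \<phi>_def m_comm[of x "j x"] m_assoc)

text \<open>In the Gaussian integers, \<open>(1 + i) ^ 2 = 2 * i\<close>.\<close>

lemma phi_phi:
  assumes "x \<in> carrier G"
  shows "\<phi> (\<phi> x) = j (x \<otimes> x)"
proof -
  have "\<phi> (\<phi> x) = (x \<otimes> j x) \<otimes> (j x \<otimes> inv x)"
    using assms by (simp add: \<phi>_def j_mult j_j)
  also have "\<dots> = (j x \<otimes> j x) \<otimes> (x \<otimes> inv x)"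
    using assms by (simp only: m_ac j_closed inv_closed m_closed)
  finally show ?thesis using assms by (simp add: j_mult)
qed

lemma phi_funpow_hom: "\<phi> ^^ n \<in> hom G G"
proof (induction n)
  case (Suc n)
  from Group.hom_compose[OF Suc phi_hom] show ?case by (simp only: funpow.simps)
qed (simp add: hom_def)

lemma phi_funpow_closed [simp]: "x \<in> carrier G \<Longrightarrow> (\<phi> ^^ n) x \<in> carrier G"
  using phi_funpow_hom by (rule hom_in_carrier)

text \<open>Up to a power of the unit \<open>i\<close>, \<open>(1 + i) ^ (2 * n)\<close> is
  \<open>2 ^ n\<close>, so both kill the same elements; \<open>phi_funpow_double\<close> is the
  other direction.\<close>

lemma phi_funpow_eq_1_imp:
  assumes "x \<in> carrier G" "(\<phi> ^^ (2 * n)) x = \<one>"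
  shows "x [^] (2 ^ n :: nat) = \<one>"
  using assms
proof (induction n arbitrary: x)
  case (Suc n)
  have "(\<phi> ^^ (2 * n)) (j (x \<otimes> x)) = \<one>"
    using Suc.prems by (simp add: funpow_swap1 phi_phi del: funpow.simps flip: funpow_Suc_right) (simp add: funpow_swap1 phi_phi)
  with Suc.IH[of "j (x \<otimes> x)"] Suc.prems(1) have "j (x \<otimes> x) [^] (2 ^ n :: nat) = \<one>" by simp
  then have "j ((x \<otimes> x) [^] (2 ^ n :: nat)) = \<one>"
    using hom_nat_pow[OF j_hom, of "x \<otimes> x"] Suc.prems(1) is_group by simp
  then have "inv ((x \<otimes> x) [^] (2 ^ n :: nat)) = j \<one>"
    using j_j[of "(x \<otimes> x) [^] (2 ^ n :: nat)"] Suc.prems(1) by simp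
  also have "j \<one> = \<one>" using hom_one[OF j_hom is_group is_group] .
  finally have "(x \<otimes> x) [^] (2 ^ n :: nat) = \<one>" using Suc.prems(1) by simp
  moreover have "x \<otimes> x = x [^] (2 :: nat)" using Suc.prems(1) by (simp add: numeral_2_eq_2)
  ultimately show ?case using Suc.prems(1) by (simp add: nat_pow_pow)
qed simp

lemma phi_funpow_double:
  assumes "x \<in> carrier G" "x [^] (2 ^ n :: nat) = \<one>"
  shows "(\<phi> ^^ (2 * n)) x = \<one>"
  using assms
proof (induction n arbitrary: x)
  case (Suc n)
  have "(x \<otimes> x) [^] (2 ^ n :: nat) = \<one>"
    using Suc.prems by (simp add: pow_mult_distrib m_comm nat_pow_mult mult_2)
  then have "j (x \<otimes> x) [^] (2 ^ n :: nat) = \<one>"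
    using hom_nat_pow[OF j_hom, of "x \<otimes> x" "2 ^ n"] hom_one[OF j_hom is_group is_group] Suc.prems(1) is_group
    by simp
  from Suc.IH[OF _ this] Suc.prems(1) show ?case by (simp add: funpow_swap1 phi_phi)
qed simp

lemma phi_image_subgroup: "subgroup ((\<phi> ^^ n) ` carrier G) G"
  using group_hom.img_is_subgroup[of G G "\<phi> ^^ n"] phi_funpow_hom is_group
  by (simp add: group_hom_def group_hom_axioms_def)

lemma phi_group_hom: "group_hom G G \<phi>"
  using phi_hom is_group by (simp add: group_hom_def group_hom_axioms_def)

lemma phi_eq_1_iff: "x \<in> carrier G \<Longrightarrow> \<phi> x = \<one> \<longleftrightarrow> j x = inv x"
  unfolding \<phi>_def by (metis inv_equality j_closed m_comm r_inv)

lemma card_phi_kernel: "card {x \<in> carrier G. \<phi> x = \<one>} = 2"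
  using card_fixed by (simp add: phi_eq_1_iff cong: conj_cong)

text \<open>The kernel of \<open>\<phi>\<close> is \<open>{\<one>, z}\<close>, so it lies in
  \<open>S\<close> and the restriction to \<open>S\<close> still has a kernel of order 2.\<close>

lemma card_phi_image:
  assumes "subgroup S G" "z \<in> S" "z \<noteq> \<one>" "\<phi> z = \<one>"
  shows "card S = 2 * card (\<phi> ` S)"
proof -
  have S: "S \<subseteq> carrier G" "\<one> \<in> S" using assms(1) by (auto simp: subgroup_def)
  have one: "\<phi> \<one> = \<one>" using hom_one[OF phi_hom is_group is_group] .
  have fin: "finite {x \<in> carrier G. \<phi> x = \<one>}" using finite_carrier by simp
  have "{\<one>, z} = {x \<in> carrier G. \<phi> x = \<one>}"
    using assms S one card_phi_kernel by (intro card_subset_eq fin) auto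
  moreover have "{\<one>, z} \<subseteq> {x \<in> S. \<phi> x = \<one>}" using assms S one by auto
  ultimately have "{x \<in> S. \<phi> x = \<one>} = {x \<in> carrier G. \<phi> x = \<one>}" using S by blast
  then show ?thesis
    using group_hom.card_subgroup_image[OF phi_group_hom assms(1)] card_phi_kernel
      finite_subset[OF S(1) finite_carrier] by simp
qed

end

section \<open>Gaussian modules of order 2^(2k+1): the chain of images and the two cyclic
  factors\<close>

locale gaussian_two_group = gaussian_group +
  fixes k :: nat
  assumes order_eq: "Coset.order G = 2 ^ (2 * k + 1)"
begin

text \<open>The order is a power of 2, so some power of \<open>1 + i\<close> kills any given
  element. The last iterate before \<open>\<one>\<close> lies in the kernel, and it stays in the
  image, which is stable under \<open>\<phi>\<close>.\<close>

lemma kernel_meets_image: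
  assumes "(\<phi> ^^ n) ` carrier G \<noteq> {\<one>}"
  obtains z where "z \<in> (\<phi> ^^ n) ` carrier G" "z \<noteq> \<one>" "\<phi> z = \<one>"
proof -
  let ?S = "(\<phi> ^^ n) ` carrier G"
  have "\<one> \<in> ?S" using phi_image_subgroup by (rule subgroup.one_closed)
  with assms obtain h where h: "h \<in> ?S" "h \<noteq> \<one>" by blast
  then have hc: "h \<in> carrier G" by auto
  have "h [^] Coset.order G = \<one>" using pow_order_eq_1[OF hc] .
  from phi_funpow_double[OF hc this[unfolded order_eq]] have ex: "\<exists>m. (\<phi> ^^ m) h = \<one>" by blast
  define m where "m = (LEAST m. (\<phi> ^^ m) h = \<one>)"
  have m: "(\<phi> ^^ m) h = \<one>" unfolding m_def using ex by (rule LeastI_ex)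
  have "m \<noteq> 0" using m h by (intro notI) simp
  then obtain m' where m': "m = Suc m'" by (cases m) auto
  have "(\<phi> ^^ m') h \<noteq> \<one>" using not_less_Least[of m' "\<lambda>m. (\<phi> ^^ m) h = \<one>"] m' m_def by auto
  moreover have "\<phi> ((\<phi> ^^ m') h) = \<one>" using m m' by simp
  moreover have "(\<phi> ^^ m') h \<in> ?S"
  proof -
    from h obtain y where y: "y \<in> carrier G" "h = (\<phi> ^^ n) y" by blast
    then have "(\<phi> ^^ m') h = (\<phi> ^^ n) ((\<phi> ^^ m') y)"
      by (metis add.commute comp_apply funpow_add)
    then show ?thesis using y by simp
  qed
  ultimately show thesis by (rule that[rotated])
qed

text \<open>A nontrivial image contains the kernel, so one more application of \<open>\<phi>\<close>
  halves it.\<close>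

lemma card_phi_funpow_image:
  "(\<phi> ^^ n) ` carrier G = {\<one>} \<or> card ((\<phi> ^^ n) ` carrier G) * 2 ^ n = 2 ^ (2 * k + 1)"
proof (induction n)
  case 0
  then show ?case using order_eq by (simp add: Coset.order_def)
next
  case (Suc n)
  let ?S = "(\<phi> ^^ n) ` carrier G"
  have S: "(\<phi> ^^ Suc n) ` carrier G = \<phi> ` ?S" by (simp add: image_comp)
  show ?case
  proof (cases "?S = {\<one>}")
    case True
    then show ?thesis unfolding S using hom_one[OF phi_hom is_group is_group] by simp
  next
    case False
    then obtain z where "z \<in> ?S" "z \<noteq> \<one>" "\<phi> z = \<one>" by (rule kernel_meets_image)
    from card_phi_image[OF phi_image_subgroup this] have "card ?S = 2 * card (\<phi> ` ?S)" .
    then show ?thesis unfolding S using Suc False by simp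
  qed
qed

lemma phi_nilpotent:
  assumes "x \<in> carrier G"
  shows "(\<phi> ^^ (2 * k + 1)) x = \<one>"
proof -
  let ?S = "(\<phi> ^^ (2 * k + 1)) ` carrier G"
  have "?S = {\<one>}"
  proof (rule ccontr)
    assume "?S \<noteq> {\<one>}"
    then have "card ?S = 1" using card_phi_funpow_image[of "2 * k + 1"] by simp
    then obtain y where "?S = {y}" by (rule card_1_singletonE)
    moreover have "\<one> \<in> ?S" using phi_image_subgroup by (rule subgroup.one_closed)
    ultimately show False using \<open>?S \<noteq> {\<one>}\<close> by simp
  qed
  then show ?thesis using assms by blast
qed

text \<open>Exponents of \<open>Q = (1 + i) P\<close> and of \<open>P\<close> define a map from the
  product of cyclic groups. It is onto, and both sides have order \<open>2 ^ (2 * k + 1)\<close>, so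
  it is bijective.\<close>

lemma iso_cyclic_product: "G \<cong> integer_mod_group (2 ^ k) \<times>\<times> integer_mod_group (2 ^ (k + 1))"
proof -
  let ?D = "\<phi> ` carrier G"
  have D: "subgroup ?D G" using phi_image_subgroup[of 1] by simp
  have "card (carrier G) = card ?D * 2"
    using group_hom.card_subgroup_image[OF phi_group_hom subgroup_self finite_carrier] card_phi_kernel
    by simp
  then have cardD: "card ?D * 2 = 2 ^ (2 * k + 1)" using order_eq by (simp add: Coset.order_def)
  then have "?D \<noteq> carrier G" using \<open>card (carrier G) = _\<close> by auto
  then obtain P where P: "P \<in> carrier G" "P \<notin> ?D" by auto
  define Q where "Q = \<phi> P"
  have Q: "Q \<in> carrier G" using P by (simp add: Q_def)
  \<comment> \<open>The subgroup \<open>?D\<close> has index 2, so it and its translate by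
    \<open>P\<close> exhaust the group.\<close>
  have cover: "x \<in> ?D \<or> (\<exists>d\<in>?D. x = P \<otimes> d)" if x: "x \<in> carrier G" for x
  proof -
    let ?P = "(\<lambda>d. P \<otimes> d) ` ?D"
    have "card ?P = card ?D" using P by (intro card_image inj_onI) auto
    moreover have "?D \<inter> ?P = {}"
    proof -
      have "P \<in> ?D" if "d \<in> ?D" "P \<otimes> d \<in> ?D" for d
      proof -
        have "P \<otimes> d \<otimes> inv d \<in> ?D"
          by (rule subgroup.m_closed[OF D that(2) subgroup.m_inv_closed[OF D that(1)]])
        moreover have "d \<in> carrier G" using that by auto
        ultimately show ?thesis using P by (simp add: m_assoc)
      qed
      then have "P \<otimes> d \<notin> ?D" if "d \<in> ?D" for d using P(2) that by metis
      then show ?thesis by (intro equals0I) (elim IntE imageE, metis imageI)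
    qed
    moreover have fin: "finite ?D" using finite_carrier by simp
    ultimately have "card (?D \<union> ?P) = card (carrier G)"
      using \<open>card (carrier G) = _\<close> by (simp add: card_Un_disjoint)
    moreover have "?D \<union> ?P \<subseteq> carrier G" using P by auto
    ultimately have "?D \<union> ?P = carrier G" using finite_carrier by (intro card_subset_eq)
    then show ?thesis using x by blast
  qed
  \<comment> \<open>The integer combinations of \<open>P\<close> and \<open>Q\<close>; closure under
    \<open>\<phi>\<close> will make them a Gaussian submodule.\<close>
  define B where "B = {Q [^] (b::int) \<otimes> P [^] (a::int) |a b. True}"
  have BI: "Q [^] (b::int) \<otimes> P [^] (a::int) \<in> B" for a b unfolding B_def by blast
  have B_mult: "x \<otimes> y \<in> B" if "x \<in> B" "y \<in> B" for x y
  proof -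
    from that obtain a b c d where "x = Q [^] (b::int) \<otimes> P [^] (a::int)"
      "y = Q [^] (d::int) \<otimes> P [^] (c::int)" unfolding B_def by blast
    then have "x \<otimes> y = Q [^] (b + d) \<otimes> P [^] (a + c)"
      using P Q by (simp add: int_pow_mult m_ac)
    then show ?thesis using BI by simp
  qed
  \<comment> \<open>This is \<open>(1 + i) ^ 2 = 2 * (1 + i) - 2\<close>, applied to
    \<open>P\<close>.\<close>
  have phi_Q: "\<phi> Q = Q [^] (2::int) \<otimes> P [^] (- 2 :: int)"
  proof -
    have "\<phi> Q = (Q \<otimes> inv P) \<otimes> (Q \<otimes> inv P)"
      using P by (simp add: Q_def phi_phi j_mult flip: j_eq)
    also have "\<dots> = (Q \<otimes> Q) \<otimes> inv (P \<otimes> P)" using P Q by (simp add: inv_mult m_ac)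
    also have "Q \<otimes> Q = Q [^] (2 :: int)" using int_pow_mult[of Q 1 1] Q by simp
    also have "P \<otimes> P = P [^] (2 :: int)" using int_pow_mult[of P 1 1] P by simp
    finally show ?thesis using P by (simp add: int_pow_neg)
  qed
  have B_phi: "\<phi> x \<in> B" if "x \<in> B" for x
  proof -
    from that obtain a b where x: "x = Q [^] (b::int) \<otimes> P [^] (a::int)" unfolding B_def by blast
    have pw: "\<phi> (y [^] (n::int)) = \<phi> y [^] n" if "y \<in> carrier G" for y n
      using group_hom.hom_int_pow[OF phi_group_hom that] .
    have "\<phi> x = \<phi> Q [^] b \<otimes> Q [^] a" unfolding x using P Q by (simp add: phi_mult pw) (simp add: Q_def)
    also have "\<phi> Q [^] b = Q [^] (2 * b) \<otimes> P [^] (- 2 * b)"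
      unfolding phi_Q using P Q by (simp add: int_pow_distrib int_pow_pow)
    also have "\<dots> \<otimes> Q [^] a = Q [^] (2 * b + a) \<otimes> P [^] (- 2 * b)"
      using P Q by (simp add: int_pow_mult m_ac)
    finally show ?thesis using BI by simp
  qed
  have PB: "(\<phi> ^^ n) P \<in> B" for n
  proof (induction n)
    case 0
    then show ?case using BI[of 0 1] P by simp
  qed (simp add: B_phi)
  \<comment> \<open>Successive approximation: the remainder \<open>y\<close> is
    \<open>\<phi> z\<close> or \<open>P \<otimes> \<phi> z\<close>, so each step moves at most one
    term \<open>(\<phi> ^^ n) P\<close> into \<open>u\<close> and leaves a remainder one power of
    \<open>\<phi>\<close> deeper. At depth \<open>2 * k + 1\<close> it vanishes.\<close>
  have gen: "\<exists>u\<in>B. \<exists>y\<in>carrier G. x = u \<otimes> (\<phi> ^^ n) y" if "x \<in> carrier G" for x n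
    using that
  proof (induction n)
    case 0
    then show ?case using BI[of 0 0] by (intro bexI[of _ \<one>] bexI[of _ x]) simp_all
  next
    case (Suc n)
    then obtain u y where u: "u \<in> B" "y \<in> carrier G" "x = u \<otimes> (\<phi> ^^ n) y" by blast
    have uc: "u \<in> carrier G" using u P Q by (auto simp: B_def)
    from cover[OF u(2)] show ?case
    proof
      assume "y \<in> ?D"
      then obtain z where "z \<in> carrier G" "y = \<phi> z" by blast
      then have "x = u \<otimes> (\<phi> ^^ Suc n) z" using u by (simp add: funpow_swap1)
      then show ?thesis using u \<open>z \<in> carrier G\<close> by blast
    next
      assume "\<exists>d\<in>?D. y = P \<otimes> d"
      then obtain z where z: "z \<in> carrier G" "y = P \<otimes> \<phi> z" by blast
      have "x = u \<otimes> ((\<phi> ^^ n) P \<otimes> (\<phi> ^^ n) (\<phi> z))"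
        unfolding u(3) z(2) using P z hom_mult[OF phi_funpow_hom, of P "\<phi> z" n] by simp
      also have "\<dots> = u \<otimes> (\<phi> ^^ n) P \<otimes> (\<phi> ^^ Suc n) z"
        using P z uc by (simp add: funpow_swap1 m_assoc)
      finally show ?thesis using B_mult[OF u(1) PB[of n]] z by blast
    qed
  qed
  have carrier_B: "carrier G \<subseteq> B"
  proof
    fix x assume "x \<in> carrier G"
    from gen[OF this, of "2 * k + 1"] obtain u y where "u \<in> B" "y \<in> carrier G"
      "x = u \<otimes> (\<phi> ^^ (2 * k + 1)) y" by blast
    moreover have "u \<in> carrier G" using \<open>u \<in> B\<close> P Q by (auto simp: B_def)
    ultimately show "x \<in> B" by (simp only: phi_nilpotent r_one)
  qed
  \<comment> \<open>For \<open>P\<close> the exponent \<open>2 * k + 1\<close> has to be rounded up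
    to the even \<open>2 * (k + 1)\<close>; for \<open>Q\<close>, one step further down, the even
    exponent \<open>2 * k\<close> suffices. Hence the bounds \<open>2 ^ (k + 1)\<close> and
    \<open>2 ^ k\<close>.\<close>
  have "(\<phi> ^^ (2 * (k + 1))) P = \<phi> ((\<phi> ^^ (2 * k + 1)) P)" by simp
  also have "\<dots> = \<one>" unfolding phi_nilpotent[OF P(1)] by (rule hom_one[OF phi_hom is_group is_group])
  finally have "P [^] (2 ^ (k + 1) :: nat) = \<one>" using phi_funpow_eq_1_imp[OF P(1)] by blast
  then have ordP: "P [^] (2 ^ (k + 1) :: int) = \<one>" by (metis int_pow_int of_nat_numeral of_nat_power)
  have "(\<phi> ^^ (2 * k)) Q = \<one>"
    using phi_nilpotent[OF P(1)] by (simp add: Q_def funpow_swap1)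
  then have "Q [^] (2 ^ k :: nat) = \<one>" using phi_funpow_eq_1_imp[OF Q] by blast
  then have ordQ: "Q [^] (2 ^ k :: int) = \<one>" by (metis int_pow_int of_nat_numeral of_nat_power)
  let ?Z = "integer_mod_group (2 ^ k) \<times>\<times> integer_mod_group (2 ^ (k + 1))"
  define F where "F = (\<lambda>(b::int, a::int). Q [^] b \<otimes> P [^] a)"
  have cZ: "carrier ?Z = {0..<2 ^ k} \<times> {0..<2 ^ (k + 1)}" by (simp add: carrier_integer_mod_group)
  have "F \<in> hom ?Z G"
  proof (rule homI)
    fix x y assume "x \<in> carrier ?Z" "y \<in> carrier ?Z"
    then show "F (x \<otimes>\<^bsub>?Z\<^esub> y) = F x \<otimes> F y"
      using P Q int_pow_mod[OF P(1) ordP] int_pow_mod[OF Q ordQ]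
      by (auto simp: F_def mult_DirProd' int_pow_mult m_ac)
  qed (use P Q in \<open>auto simp: F_def\<close>)
  moreover have img: "F ` carrier ?Z = carrier G"
  proof
    show "F ` carrier ?Z \<subseteq> carrier G" using P Q by (auto simp: F_def)
    show "carrier G \<subseteq> F ` carrier ?Z"
    proof
      fix x assume "x \<in> carrier G"
      with carrier_B obtain a b where x: "x = Q [^] (b::int) \<otimes> P [^] (a::int)" unfolding B_def by blast
      also have "\<dots> = F (b mod 2 ^ k, a mod 2 ^ (k + 1))"
        unfolding F_def using int_pow_mod[OF P(1) ordP] int_pow_mod[OF Q ordQ] by simp
      finally show "x \<in> F ` carrier ?Z" unfolding cZ by auto
    qed
  qed
  moreover have "inj_on F (carrier ?Z)"
  proof (rule eq_card_imp_inj_on)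
    show "finite (carrier ?Z)" unfolding cZ by simp
    have "card (carrier ?Z) = 2 ^ k * 2 ^ (k + 1)"
      unfolding cZ by (simp add: card_cartesian_product nat_power_eq nat_mult_distrib)
    also have "\<dots> = 2 ^ (k + (k + 1))" by (simp only: power_add)
    also have "k + (k + 1) = 2 * k + 1" by simp
    finally have "card (carrier ?Z) = 2 ^ (2 * k + 1)" .
    then show "card (F ` carrier ?Z) = card (carrier ?Z)"
      unfolding img using order_eq by (simp only: Coset.order_def)
  qed
  ultimately have "F \<in> iso ?Z G" by (simp add: iso_def bij_betw_def)
  then have "?Z \<cong> G" unfolding is_iso_def by blast
  moreover have "Group.group ?Z" by (intro DirProd_group group_integer_mod_group)
  ultimately show ?thesis by (rule group.iso_sym[rotated])
qed

end

section \<open>Jacobsthal sums\<close>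

definition quad_char :: "'a::field \<Rightarrow> int" ("\<chi>")
  where "\<chi> x = (if x = 0 then 0 else if \<exists>y. x = y ^ 2 then 1 else - 1)"

lemma quad_char_0 [simp]: "\<chi> 0 = 0"
  by (simp add: quad_char_def)

lemma quad_char_1 [simp]: "\<chi> 1 = 1"
  unfolding quad_char_def by (metis one_neq_zero power_one)

lemma quad_char_square [simp]: "x \<noteq> 0 \<Longrightarrow> \<chi> (x ^ 2) = 1"
  by (auto simp: quad_char_def)

lemma quad_char_values: "x \<noteq> 0 \<Longrightarrow> \<chi> x = 1 \<or> \<chi> x = - 1"
  by (simp add: quad_char_def)

lemma quad_char_square_mult:
  assumes "t \<noteq> 0"
  shows "\<chi> (t ^ 2 * x) = \<chi> x"
proof -
  have "(\<exists>y. t ^ 2 * x = y ^ 2) \<longleftrightarrow> (\<exists>y. x = y ^ 2)"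
  proof
    assume "\<exists>y. t ^ 2 * x = y ^ 2"
    then obtain y where "t ^ 2 * x = y ^ 2" by blast
    then have "x = (y / t) ^ 2" using assms by (simp add: power_divide field_simps)
    then show "\<exists>y. x = y ^ 2" by blast
  qed (metis power_mult_distrib)
  then show ?thesis using assms by (simp add: quad_char_def)
qed

lemma card_square_roots:
  fixes x :: "'a::field"
  assumes two: "(2::'a) \<noteq> 0"
  shows "int (card {y. y ^ 2 = x}) = 1 + \<chi> x"
proof -
  consider "x = 0" | y where "x \<noteq> 0" "x = y ^ 2" | "x \<noteq> 0" "\<nexists>y. x = y ^ 2" by blast
  then show ?thesis
  proof cases
    case 1
    then have "{y. y ^ 2 = x} = {0}" by auto
    with 1 show ?thesis by simp
  next
    case 2
    then have "{z. z ^ 2 = x} = {y, - y}" by (auto simp: power2_eq_iff)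
    moreover have "y \<noteq> - y"
    proof
      assume "y = - y"
      then have "2 * y = 0" by (simp add: eq_neg_iff_add_eq_0)
      with two 2 show False by simp
    qed
    ultimately show ?thesis using 2 by simp
  next
    case 3
    then have "{y. y ^ 2 = x} = {}" by auto
    with 3 show ?thesis by (simp add: quad_char_def)
  qed
qed

text \<open>When 2 is nonzero, the excess of the number of affine points of
  \<open>y ^ 2 = x ^ 3 - n * x\<close> over the size of the field.\<close>

definition jacobsthal :: "'a::{field,finite} \<Rightarrow> int"
  where "jacobsthal n = (\<Sum>x\<in>UNIV. \<chi> (x ^ 3 - n * x))"

context
  assumes two: "(2 :: 'a::{field,finite}) \<noteq> 0"
begin

text \<open>Grouping \<open>t\<close> by its square counts \<open>n\<close> once for each of its
  \<open>1 + \<chi> n\<close> square roots.\<close>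

lemma sum_squares:
  fixes g :: "'a \<Rightarrow> int"
  shows "(\<Sum>t\<in>UNIV. g (t ^ 2)) = (\<Sum>n\<in>UNIV. (1 + \<chi> n) * g n)"
proof -
  have "(\<Sum>t\<in>UNIV. g (t ^ 2)) = (\<Sum>n\<in>UNIV. \<Sum>t | t \<in> UNIV \<and> t ^ 2 = n. g (t ^ 2))"
    by (rule sum.group[symmetric]) auto
  also have "\<dots> = (\<Sum>n\<in>UNIV. (1 + \<chi> n) * g n)"
  proof (rule sum.cong[OF refl])
    fix n :: 'a
    have "(\<Sum>t | t \<in> UNIV \<and> t ^ 2 = n. g (t ^ 2)) = (\<Sum>t | t ^ 2 = n. g n)"
      by (rule sum.cong) auto
    also have "\<dots> = (1 + \<chi> n) * g n" by (simp flip: card_square_roots[OF two])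
    finally show "(\<Sum>t | t \<in> UNIV \<and> t ^ 2 = n. g (t ^ 2)) = (1 + \<chi> n) * g n" .
  qed
  finally show ?thesis .
qed

lemma sum_quad_char: "(\<Sum>x\<in>UNIV. \<chi> (x::'a)) = 0"
  using sum_squares[of "\<lambda>_. 1"] by (simp add: sum.distrib)

lemma sum_scale: "c \<noteq> 0 \<Longrightarrow> (\<Sum>x\<in>UNIV. g (c * x)) = (\<Sum>x\<in>UNIV. g (x::'a))"
  by (rule sum.reindex_bij_witness[of _ "\<lambda>x. x / c" "\<lambda>x. c * x"]) auto

text \<open>For a nonsquare \<open>n\<close>, every term of the vanishing sum of \<open>\<chi> x + \<chi> (n * x)\<close> is at most zero.\<close>

lemma quad_char_mult: "\<chi> (x * y :: 'a) = \<chi> x * \<chi> y"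
proof -
  have nn: "\<chi> (n * z) = 1" if n: "n \<noteq> 0" "\<nexists>t. n = t ^ 2" and z: "z \<noteq> 0" "\<nexists>t. z = t ^ 2" for n z :: 'a
  proof -
    have neg: "\<chi> x + \<chi> (n * x) \<le> 0" for x
    proof (cases "x = 0 \<or> (\<nexists>t. x = t ^ 2)")
      case True
      then show ?thesis by (auto simp: quad_char_def)
    next
      case False
      then obtain t where t: "x = t ^ 2" "t \<noteq> 0" by auto
      then have "\<chi> (n * x) = \<chi> n" using quad_char_square_mult[of t n] by (simp add: mult.commute)
      also have "\<dots> = - 1" using n by (simp add: quad_char_def)
      finally show ?thesis using t by simp
    qed
    have "(\<Sum>x\<in>UNIV. \<chi> x + \<chi> (n * x)) = 0"
      using sum_scale[OF n(1), of \<chi>] by (simp add: sum.distrib sum_quad_char)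
    moreover have "(\<Sum>x\<in>UNIV. - (\<chi> x + \<chi> (n * x))) = - (\<Sum>x\<in>UNIV. \<chi> x + \<chi> (n * x))"
      by (rule sum_negf)
    ultimately have "(\<Sum>x\<in>UNIV. - (\<chi> x + \<chi> (n * x))) = 0" by simp
    moreover have "(\<Sum>x\<in>UNIV. - (\<chi> x + \<chi> (n * x))) = 0 \<longleftrightarrow> (\<forall>x\<in>UNIV. - (\<chi> x + \<chi> (n * x)) = 0)"
      by (rule sum_nonneg_eq_0_iff) (simp_all only: finite neg neg_0_le_iff_le)
    ultimately have "\<forall>x\<in>UNIV. - (\<chi> x + \<chi> (n * x)) = 0" by (simp only:)
    then have "\<chi> z + \<chi> (n * z) = 0" by (metis UNIV_I neg_equal_0_iff_equal)
    moreover have "\<chi> z = - 1" using z by (simp add: quad_char_def)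
    ultimately show ?thesis by simp
  qed
  consider "x = 0 \<or> y = 0" | t where "x = t ^ 2" "t \<noteq> 0" | t where "y = t ^ 2" "t \<noteq> 0"
    | "x \<noteq> 0" "y \<noteq> 0" "\<nexists>t. x = t ^ 2" "\<nexists>t. y = t ^ 2"
    by (metis zero_eq_power2)
  then show ?thesis
  proof cases
    case 4
    then show ?thesis using nn[of x y] by (simp add: quad_char_def)
  qed (auto simp: quad_char_square_mult mult.commute[of x])
qed

lemma quad_char_power: "\<chi> ((x::'a) ^ n) = \<chi> x ^ n"
  by (induction n) (simp_all add: quad_char_mult)

lemma quad_char_sq: "\<chi> (x::'a) * \<chi> x = (if x = 0 then 0 else 1)"
  using quad_char_values[of x] by auto

text \<open>For distinct \<open>a\<close> and \<open>b\<close>, shift to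
  \<open>\<chi> (u * (u + c))\<close> and divide by the square \<open>u ^ 2\<close>. Then
  \<open>1 + c / u\<close> runs over everything except 1, so \<open>- \<chi> 1\<close> remains of
  the vanishing total.\<close>

lemma sum_quad_char_shifted:
  "(\<Sum>n\<in>UNIV. \<chi> (n - a :: 'a) * \<chi> (n - b)) = (if a = b then int CARD('a) else 0) - 1"
proof (cases "a = b")
  case True
  have "(\<Sum>n\<in>UNIV. \<chi> (n - a :: 'a) * \<chi> (n - b)) = (\<Sum>n\<in>UNIV. if n = a then 0 else 1)"
    unfolding True quad_char_sq by simp
  also have "\<dots> = (\<Sum>n\<in>UNIV - {a}. 1)"
    by (intro sum.mono_neutral_cong_right) auto
  also have "\<dots> = int CARD('a) - 1" by (simp add: card_Diff_singleton)
  finally show ?thesis using True by simp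
next
  case False
  define c where "c = a - b"
  have c: "c \<noteq> 0" using False by (simp add: c_def)
  have "(\<Sum>n\<in>UNIV. \<chi> (n - a :: 'a) * \<chi> (n - b)) = (\<Sum>u\<in>UNIV. \<chi> u * \<chi> (u + c))"
    by (rule sum.reindex_bij_witness[of _ "\<lambda>u. u + a" "\<lambda>n. n - a"]) (auto simp: c_def)
  also have "\<dots> = (\<Sum>u\<in>UNIV - {0}. \<chi> u * \<chi> (u + c))"
    by (intro sum.mono_neutral_right) auto
  also have "\<dots> = (\<Sum>u\<in>UNIV - {0}. \<chi> (1 + c / u))"
  proof (rule sum.cong[OF refl])
    fix u :: 'a assume "u \<in> UNIV - {0}"
    then have u: "u \<noteq> 0" by simp
    then have "u * (u + c) = u ^ 2 * (1 + c / u)" by (simp add: field_simps power2_eq_square)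
    then show "\<chi> u * \<chi> (u + c) = \<chi> (1 + c / u)"
      using quad_char_square_mult[OF u] by (simp flip: quad_char_mult)
  qed
  also have "\<dots> = (\<Sum>v\<in>UNIV - {1}. \<chi> (v::'a))"
    by (rule sum.reindex_bij_witness[of _ "\<lambda>v. c / (v - 1)" "\<lambda>u. 1 + c / u"]) (use c in auto)
  also have "\<dots> = (\<Sum>v\<in>UNIV. \<chi> (v::'a)) - \<chi> (1::'a)"
    by (simp add: sum_diff1)
  finally show ?thesis using False by (simp add: sum_quad_char)
qed

lemma jacobsthal_0: "jacobsthal (0::'a) = 0"
proof -
  have "\<chi> (x ^ 3) = \<chi> x" for x :: 'a
    using quad_char_values[of x] by (cases "x = 0") (auto simp: quad_char_power)
  then show ?thesis by (simp add: jacobsthal_def sum_quad_char)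
qed

text \<open>The substitution \<open>x = t * z\<close> pulls out \<open>\<chi> (t ^ 3)\<close>, a
  sign that squaring removes.\<close>

lemma jacobsthal_scale:
  assumes "t \<noteq> (0::'a)"
  shows "jacobsthal (n * t ^ 2) ^ 2 = jacobsthal n ^ 2"
proof -
  have "jacobsthal (n * t ^ 2) = (\<Sum>z\<in>UNIV. \<chi> ((t * z) ^ 3 - n * t ^ 2 * (t * z)))"
    unfolding jacobsthal_def by (rule sum_scale[OF assms, symmetric])
  also have "\<dots> = (\<Sum>z\<in>UNIV. \<chi> (t ^ 3) * \<chi> (z ^ 3 - n * z))"
    unfolding quad_char_mult[symmetric]
    by (intro sum.cong refl arg_cong[where f = \<chi>])
      (simp add: algebra_simps power2_eq_square power3_eq_cube)
  also have "\<dots> = \<chi> (t ^ 3) * jacobsthal n"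
    by (simp add: jacobsthal_def sum_distrib_left)
  finally show ?thesis
    using quad_char_values[of "t ^ 3"] assms by (auto simp: power_mult_distrib)
qed

text \<open>Expand the square over pairs \<open>x\<close>, \<open>y\<close> and sum over
  \<open>n\<close> first. The constant \<open>- 1\<close> of the shifted sums is killed by the sum
  of \<open>\<chi> y\<close>. The rest lives on \<open>y = x\<close> and \<open>y = - x\<close>,
  which contribute equally because \<open>\<chi> (- 1) = 1\<close>.\<close>

lemma sum_jacobsthal_squares:
  assumes "\<chi> (- 1 :: 'a) = 1"
  shows "(\<Sum>n\<in>UNIV. jacobsthal (n::'a) ^ 2) = 2 * int CARD('a) * (int CARD('a) - 1)"
proof -
  let ?q = "int CARD('a)"
  \<comment> \<open>Factoring out \<open>- x\<close> leaves \<open>n\<close> in a linear factor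
    only, the form to which the shifted sums apply.\<close>
  have J: "jacobsthal n = (\<Sum>x\<in>UNIV. \<chi> x * \<chi> (n - x ^ 2))" for n :: 'a
    unfolding jacobsthal_def
  proof (rule sum.cong[OF refl])
    fix x :: 'a
    have "x ^ 3 - n * x = - 1 * (x * (n - x ^ 2))"
      by (simp add: algebra_simps power2_eq_square power3_eq_cube)
    then show "\<chi> (x ^ 3 - n * x) = \<chi> x * \<chi> (n - x ^ 2)"
      by (simp only: quad_char_mult assms mult_1)
  qed
  have "(\<Sum>n\<in>UNIV. jacobsthal (n::'a) ^ 2) =
      (\<Sum>n\<in>UNIV. \<Sum>x\<in>UNIV. \<Sum>y\<in>UNIV. (\<chi> x * \<chi> y) * (\<chi> (n - x ^ 2 :: 'a) * \<chi> (n - y ^ 2)))"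
    unfolding J power2_eq_square[of "sum _ _"] sum_product by (simp add: ac_simps)
  also have "\<dots> = (\<Sum>x\<in>UNIV. \<Sum>n\<in>UNIV. \<Sum>y\<in>UNIV. (\<chi> x * \<chi> y) * (\<chi> (n - x ^ 2 :: 'a) * \<chi> (n - y ^ 2)))"
    by (rule sum.swap)
  also have "\<dots> = (\<Sum>x\<in>UNIV. \<Sum>y\<in>UNIV. \<Sum>n\<in>UNIV. (\<chi> x * \<chi> y) * (\<chi> (n - x ^ 2 :: 'a) * \<chi> (n - y ^ 2)))"
    by (intro sum.cong refl sum.swap)
  also have "\<dots> = (\<Sum>x\<in>UNIV. \<Sum>y\<in>UNIV. (\<chi> x * \<chi> y) * ((if x ^ 2 = (y ^ 2 :: 'a) then ?q else 0) - 1))"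
    by (simp add: sum_quad_char_shifted flip: sum_distrib_left)
  also have "\<dots> = (\<Sum>x\<in>UNIV. (if x = (0::'a) then 0 else 2 * ?q))"
  proof (rule sum.cong[OF refl])
    fix x :: 'a
    have "(\<Sum>y\<in>UNIV. (\<chi> x * \<chi> y) * ((if x ^ 2 = y ^ 2 then ?q else 0) - 1)) =
        \<chi> x * ?q * (\<Sum>y\<in>UNIV. if y ^ 2 = x ^ 2 then \<chi> y else 0) - \<chi> x * (\<Sum>y\<in>UNIV. \<chi> (y::'a))"
      unfolding sum_distrib_left sum_subtractf[symmetric]
      by (rule sum.cong) (auto simp: algebra_simps)
    also have "(\<Sum>y\<in>UNIV. if y ^ 2 = x ^ 2 then \<chi> y else 0) = (\<Sum>y\<in>{x, - x}. \<chi> y)"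
      by (rule sum.mono_neutral_cong_right) (auto simp: power2_eq_iff)
    also have "\<chi> x * ?q * \<dots> = (if x = 0 then 0 else 2 * ?q)"
    proof (cases "x = 0")
      case False
      have "x \<noteq> - x"
      proof
        assume "x = - x"
        then have "2 * x = 0" by (simp add: eq_neg_iff_add_eq_0)
        with two False show False by simp
      qed
      moreover have "\<chi> (- x) = \<chi> x" using quad_char_mult[of "- 1" x] assms by simp
      moreover have "\<chi> x * ?q * (\<chi> x + \<chi> x) = 2 * ?q * (\<chi> x * \<chi> x)" by simp
      ultimately show ?thesis using False by (simp add: quad_char_sq)
    qed simp
    finally show "(\<Sum>y\<in>UNIV. (\<chi> x * \<chi> y) * ((if x ^ 2 = y ^ 2 then ?q else 0) - 1)) =
        (if x = 0 then 0 else 2 * ?q)" by (simp add: sum_quad_char)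
  qed
  also have "\<dots> = (\<Sum>x\<in>UNIV - {0::'a}. 2 * ?q)"
    by (intro sum.mono_neutral_cong_right) auto
  also have "\<dots> = 2 * ?q * (?q - 1)" by (simp add: card_Diff_singleton)
  finally show ?thesis .
qed

text \<open>The square of \<open>jacobsthal n\<close> depends only on the square class of \<open>n\<close>, so the sum over all \<open>n\<close>
  contains the values at \<open>1\<close> and at a nonsquare \<open>N\<close> with the same frequency.\<close>

lemma jacobsthal_sum_of_squares:
  assumes "\<chi> (- 1 :: 'a) = 1"
  obtains N where "jacobsthal (1::'a) ^ 2 + jacobsthal (N::'a) ^ 2 = 4 * int CARD('a)"
proof -
  let ?q = "int CARD('a)"
  \<comment> \<open>The values of \<open>\<chi>\<close> sum to 0 and \<open>\<chi> 1 = 1\<close>, so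
    some value is negative.\<close>
  have "\<exists>N::'a. \<chi> N = - 1"
  proof (rule ccontr)
    assume "\<not> ?thesis"
    then have nn: "\<chi> x \<ge> 0" for x :: 'a using quad_char_values[of x] by (cases "x = 0") auto
    have "\<chi> (1::'a) \<le> (\<Sum>x\<in>UNIV. \<chi> (x::'a))" by (rule member_le_sum) (simp_all add: nn)
    then show False by (simp add: sum_quad_char)
  qed
  then obtain N :: 'a where N: "\<chi> N = - 1" by blast
  then have N0: "N \<noteq> 0" by auto
  have orbit: "(\<Sum>t\<in>UNIV. jacobsthal (n * t ^ 2) ^ 2) = (?q - 1) * jacobsthal n ^ 2" for n :: 'a
  proof -
    have "(\<Sum>t\<in>UNIV. jacobsthal (n * t ^ 2) ^ 2) = (\<Sum>t\<in>UNIV - {0::'a}. jacobsthal n ^ 2)"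
      by (intro sum.mono_neutral_cong_right) (auto simp: jacobsthal_0 jacobsthal_scale)
    then show ?thesis by (simp add: card_Diff_singleton)
  qed
  have 1: "(?q - 1) * jacobsthal (1::'a) ^ 2 = (\<Sum>n\<in>UNIV. (1 + \<chi> n) * jacobsthal (n::'a) ^ 2)"
    using orbit[of 1] sum_squares[of "\<lambda>n. jacobsthal n ^ 2"] by simp
  have "(?q - 1) * jacobsthal N ^ 2 = (\<Sum>n\<in>UNIV. (1 + \<chi> n) * jacobsthal (N * n) ^ 2)"
    using orbit[of N] sum_squares[of "\<lambda>n. jacobsthal (N * n) ^ 2"] by simp
  \<comment> \<open>Since \<open>\<chi> N = - 1\<close>, the weight \<open>1 + \<chi> n\<close>
    becomes \<open>1 - \<chi> (N * n)\<close>. After rescaling, the weights of the two sums add to 2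
    at every \<open>n\<close>, also at 0.\<close>
  also have "\<dots> = (\<Sum>n\<in>UNIV. (1 - \<chi> (N * n)) * jacobsthal (N * n) ^ 2)"
    by (simp add: quad_char_mult N)
  also have "\<dots> = (\<Sum>n\<in>UNIV. (1 - \<chi> n) * jacobsthal (n::'a) ^ 2)"
    using sum_scale[OF N0, of "\<lambda>n. (1 - \<chi> n) * jacobsthal n ^ 2"] .
  finally have "(?q - 1) * jacobsthal (1::'a) ^ 2 + (?q - 1) * jacobsthal N ^ 2 =
      (\<Sum>n\<in>UNIV. (1 + \<chi> n) * jacobsthal (n::'a) ^ 2 + (1 - \<chi> n) * jacobsthal n ^ 2)"
    unfolding 1 by (simp add: sum.distrib)
  also have "\<dots> = 2 * (\<Sum>n\<in>UNIV. jacobsthal (n::'a) ^ 2)"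
    unfolding sum_distrib_left by (intro sum.cong refl) (simp add: algebra_simps)
  also have "\<dots> = (?q - 1) * (4 * ?q)" unfolding sum_jacobsthal_squares[OF assms] by simp
  finally have "(?q - 1) * (jacobsthal (1::'a) ^ 2 + jacobsthal N ^ 2) = (?q - 1) * (4 * ?q)"
    by (simp add: algebra_simps)
  moreover have "?q - 1 \<noteq> 0"
  proof -
    have "card {0::'a, 1} \<le> CARD('a)" by (rule card_mono) auto
    then show ?thesis by simp
  qed
  ultimately show thesis using that by simp
qed

end

section \<open>The group of the curve over a prime field\<close>

text \<open>By the two-square identity \<open>(a c + b d) ^ 2 + (a d - b c) ^ 2 = p ^ 2\<close>, the
  quotient \<open>m\<close> of \<open>a d - b c\<close> by \<open>p\<close> has \<open>m ^ 2\<close>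
  at most 1; either value makes one of the two squares vanish.\<close>

lemma prime_sum_two_squares_aux:
  fixes a b c d p :: int
  assumes p: "p > 0" and ab: "a ^ 2 + b ^ 2 = p" and cd: "c ^ 2 + d ^ 2 = p"
    and dvd: "p dvd a * d - b * c"
  shows "a ^ 2 = c ^ 2 \<or> a ^ 2 = d ^ 2"
proof -
  have b2: "b ^ 2 = p - a ^ 2" and c2: "c ^ 2 = p - d ^ 2" and d2: "d ^ 2 = p - c ^ 2"
    using ab cd by simp_all
  obtain m where m: "a * d - b * c = p * m" using dvd by blast
  have "(a * c + b * d) ^ 2 + (a * d - b * c) ^ 2 = (a ^ 2 + b ^ 2) * (c ^ 2 + d ^ 2)"
    by (simp add: algebra_simps power2_eq_square)
  then have eq: "(a * c + b * d) ^ 2 + p ^ 2 * m ^ 2 = p ^ 2"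
    unfolding ab cd m by (simp only: power_mult_distrib power2_eq_square[of p])
  then have "p ^ 2 * m ^ 2 \<le> p ^ 2 * 1" using zero_le_power2[of "a * c + b * d"] by linarith
  then have "m ^ 2 \<le> 1" using p by (simp only: mult_le_cancel_left_pos zero_less_power)
  then have "m ^ 2 = 0 \<or> m ^ 2 = 1" using zero_le_power2[of m] by linarith
  then show ?thesis
  proof
    assume "m ^ 2 = 0"
    then have "a * d = b * c" using m by simp
    then have "(a * d) ^ 2 = (b * c) ^ 2" by simp
    then have "a ^ 2 * (p - c ^ 2) = (p - a ^ 2) * c ^ 2"
      unfolding b2[symmetric] d2[symmetric] by (simp only: power_mult_distrib)
    then have "p * a ^ 2 = p * c ^ 2" by (simp add: algebra_simps)
    then show ?thesis using p by simp
  next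
    assume "m ^ 2 = 1"
    then have "a * c = - (b * d)" using eq by simp
    then have "(a * c) ^ 2 = (b * d) ^ 2" by simp
    then have "a ^ 2 * (p - d ^ 2) = (p - a ^ 2) * d ^ 2"
      unfolding b2[symmetric] c2[symmetric] by (simp only: power_mult_distrib)
    then have "p * a ^ 2 = p * d ^ 2" by (simp add: algebra_simps)
    then show ?thesis using p by simp
  qed
qed

text \<open>The prime divides \<open>(a d - b c) (a d + b c)\<close>, and replacing \<open>c\<close>
  by \<open>- c\<close> exchanges the factors.\<close>

lemma prime_sum_two_squares_unique:
  fixes a b c d p :: int
  assumes p: "prime p" and ab: "a ^ 2 + b ^ 2 = p" and cd: "c ^ 2 + d ^ 2 = p"
  shows "a ^ 2 = c ^ 2 \<or> a ^ 2 = d ^ 2"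
proof -
  have p0: "p > 0" using p by (simp add: prime_gt_0_int)
  have "(a * d - b * c) * (a * d + b * c) = a ^ 2 * d ^ 2 - b ^ 2 * c ^ 2"
    by (simp add: algebra_simps power2_eq_square)
  also have "\<dots> = a ^ 2 * (p - c ^ 2) - (p - a ^ 2) * c ^ 2"
  proof -
    have "d ^ 2 = p - c ^ 2" "b ^ 2 = p - a ^ 2" using ab cd by simp_all
    then show ?thesis by (simp only:)
  qed
  also have "\<dots> = p * (a ^ 2 - c ^ 2)" by (simp add: algebra_simps)
  finally have "p dvd (a * d - b * c) * (a * d + b * c)" by simp
  then have "p dvd a * d - b * c \<or> p dvd a * d - b * (- c)"
    using p by (simp add: prime_dvd_mult_iff)
  then show ?thesis
    using prime_sum_two_squares_aux[OF p0 ab, of c d] prime_sum_two_squares_aux[OF p0 ab, of "- c" d] cd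
    by auto
qed

section \<open>Multiplication by i on the curve\<close>

fun curve_i :: "'a::field \<Rightarrow> 'a ec_point \<Rightarrow> 'a ec_point" where
  "curve_i i Infinity = Infinity"
| "curve_i i (Point x y) = Point (- x) (i * y)"

text \<open>The map is linear, so it carries chords to chords and tangents to tangents; the slope
  \<open>l\<close> becomes \<open>- i * l\<close>, with square \<open>- (l ^ 2)\<close>.\<close>

lemma curve_i_add:
  fixes i :: "'a::field"
  assumes i: "i ^ 2 = - 1"
  shows "curve_i i (curve_add P Q) = curve_add (curve_i i P) (curve_i i Q)"
proof (cases "(P, Q)" rule: curve_add.cases)
  case (3 x1 y1 x2 y2)
  have i0: "i \<noteq> 0" using i by auto
  have ii: "i * i = - 1" using i by (simp add: power2_eq_square)
  show ?thesis
  proof (cases "x1 = x2 \<and> y2 = - y1")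
    case True
    then show ?thesis using 3 by simp
  next
    case False
    define l where "l = chord_slope x1 y1 x2 y2"
    have False': "\<not> (- x1 = - x2 \<and> i * y2 = - (i * y1))"
    proof
      assume *: "- x1 = - x2 \<and> i * y2 = - (i * y1)"
      then have "i * y2 = i * (- y1)" by simp
      then show False using False i0 * unfolding mult_left_cancel[OF i0] by simp
    qed
    have inv_i: "inverse i = - i" using ii by (intro inverse_unique) simp
    have slope: "chord_slope (- x1) (i * y1) (- x2) (i * y2) = - i * l"
    proof (cases "x1 = x2")
      case True
      have "A / (2 * (i * y1)) = inverse i * (A / (2 * y1))" for A
        by (simp only: divide_inverse inverse_mult_distrib mult_ac)
      then show ?thesis using True unfolding l_def chord_slope_def by (simp only: inv_i) simp
    next
      case ne: False
      have "(i * y2 - i * y1) / (- x2 - - x1) = - i * ((y2 - y1) / (x2 - x1))"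
        using ne by (simp add: divide_simps) (simp add: algebra_simps)
      then show ?thesis using ne unfolding l_def chord_slope_def by simp
    qed
    have sq: "(- i * l) ^ 2 = - (l ^ 2)" by (simp add: power_mult_distrib i)
    have "curve_add (curve_i i P) (curve_i i Q) =
       Point (- (l ^ 2) + x1 + x2) (- i * l * (- x1 - (- (l ^ 2) + x1 + x2)) - i * y1)"
      using 3 False' by (simp only: curve_i.simps curve_add.simps slope Let_def sq if_False prod.inject diff_minus_eq_add)
    moreover have "curve_add P Q = Point (l ^ 2 - x1 - x2) (l * (x1 - (l ^ 2 - x1 - x2)) - y1)"
      using 3 False by (simp only: curve_add.simps l_def Let_def if_False prod.inject)
    ultimately show ?thesis by (simp add: algebra_simps)
  qed
qed simp_all

context
  assumes two: "(2 :: 'a::{field,finite}) \<noteq> 0"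
begin

lemma curve_inv: "P \<in> curve \<Longrightarrow> inv\<^bsub>curve_group\<^esub> P = curve_neg (P :: 'a ec_point)"
  using comm_group_curve[OF two]
  by (intro group.inv_equality) (cases P; simp add: comm_group_def)+

lemma curve_Sigma:
  "(curve :: 'a ec_point set) = insert Infinity ((\<lambda>(x, y). Point x y) ` (SIGMA x:UNIV. {y. y ^ 2 = x ^ 3 - x}))"
  by (auto simp: curve_def)

lemma finite_curve: "finite (curve :: 'a ec_point set)"
  unfolding curve_Sigma by simp

text \<open>Each \<open>x\<close> carries \<open>1 + \<chi> (x ^ 3 - x)\<close> points, and one more
  lies at infinity.\<close>

lemma card_curve: "int (card (curve :: 'a ec_point set)) = 1 + int CARD('a) + jacobsthal (1::'a)"
proof -
  let ?S = "SIGMA x:(UNIV :: 'a set). {y. y ^ 2 = x ^ 3 - x}"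
  have "inj_on (\<lambda>(x, y). Point x y) ?S" by (auto simp: inj_on_def)
  then have "card (curve :: 'a ec_point set) = Suc (card ?S)"
    unfolding curve_Sigma by (subst card_insert_disjoint) (auto simp: card_image)
  also have "card ?S = (\<Sum>x\<in>(UNIV::'a set). card {y. y ^ 2 = x ^ 3 - x})"
    by (simp add: card_SigmaI)
  finally show ?thesis
    by (simp add: card_square_roots[OF two] sum.distrib jacobsthal_def)
qed

text \<open>Applied twice, the map is the reflection, which is the inverse. If
  \<open>(- x, i y) = (x, - y)\<close> then \<open>x = 0\<close>, hence \<open>y = 0\<close>, so the
  kernel of \<open>1 + i\<close> is \<open>Infinity\<close> and \<open>(0, 0)\<close>.\<close>

lemma gaussian_group_curve:
  assumes i: "(i :: 'a) ^ 2 = - 1"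
  shows "gaussian_group curve_group (curve_i i)"
proof -
  interpret comm_group "curve_group :: 'a ec_point monoid" by (rule comm_group_curve[OF two])
  have ii: "i * i = - 1" using i by (simp add: power2_eq_square)
  have closed: "curve_i i P \<in> curve" if "P \<in> curve" for P
    using that by (cases P) (auto simp: power_mult_distrib i)
  have neg: "x = - x \<longleftrightarrow> x = 0" for x :: 'a
    using two by (metis add_eq_0_iff2 mult_2 mult_eq_0_iff neg_0_equal_iff_equal)
  show ?thesis
  proof
    show "finite (carrier (curve_group :: 'a ec_point monoid))" by (simp add: finite_curve)
    show "curve_i i \<in> hom curve_group curve_group"
      by (rule homI) (simp_all add: closed curve_i_add[OF i])
    show "curve_i i (curve_i i P) = inv\<^bsub>curve_group\<^esub> P" if "P \<in> carrier curve_group" for P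
      using that by (cases P) (simp_all add: curve_inv ii flip: mult.assoc)
    have "{P \<in> carrier curve_group. curve_i i P = inv\<^bsub>curve_group\<^esub> P} = {Infinity, Point 0 0}"
      (is "?L = ?R")
    proof
      show "?L \<subseteq> ?R"
      proof
        fix P assume P: "P \<in> ?L"
        show "P \<in> ?R"
        proof (cases P)
          case (Point x y)
          with P have "x = - x" "y ^ 2 = x ^ 3 - x" by (auto simp: curve_inv)
          then show ?thesis using neg[of x] Point by simp
        qed simp
      qed
    qed (auto simp: curve_inv)
    then show "card {P \<in> carrier curve_group. curve_i i P = inv\<^bsub>curve_group\<^esub> P} = 2" by simp
  qed
qed

text \<open>The kernel of \<open>1 + i\<close> is generated by \<open>(0, 0) = (1 + i)\<^sup>2 (i, 1 - i)\<close>.\<close>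

lemma eight_dvd_card_curve:
  assumes i: "(i :: 'a) ^ 2 = - 1"
  shows "8 dvd card (curve :: 'a ec_point set)"
proof -
  interpret gaussian_group curve_group "curve_i i" by (rule gaussian_group_curve[OF i])
  have ii: "i * i = - 1" using i by (simp add: power2_eq_square)
  have i0: "i \<noteq> 0" using i by auto
  have P0: "Point i (1 - i) \<in> curve"
    using ii by (simp add: power2_eq_square power3_eq_cube algebra_simps)
  have "- i - i = - (2 * i)" by simp
  then have ne: "- i - i \<noteq> 0" using i0 two by simp
  then have ne': "i \<noteq> - i" by auto
  have "chord_slope i (1 - i) (- i) (i * (1 - i)) = - 1"
  proof -
    have "i * (1 - i) - (1 - i) = - (- i - i)" using ii by (simp add: algebra_simps)
    then have "(i * (1 - i) - (1 - i)) / (- i - i) = - 1"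
      using ne by (metis divide_self minus_divide_left)
    then show ?thesis using ne' by (simp only: chord_slope_def if_False)
  qed
  then have 1: "\<phi> (Point i (1 - i)) = Point 1 0"
    using ne' by (simp add: \<phi>_def Let_def)
  have "(1::'a) \<noteq> - 1" using two by (metis add_eq_0_iff2 one_add_one)
  then have 2: "\<phi> (Point 1 0) = Point 0 0"
    by (simp add: \<phi>_def Let_def chord_slope_def)
  have "Point 0 0 \<in> (\<phi> ^^ 0) ` carrier curve_group" by simp
  moreover have "Point 0 0 \<in> (\<phi> ^^ 1) ` carrier curve_group"
    using 2 by (intro image_eqI[of _ _ "Point 1 0"]) simp_all
  moreover have "Point 0 0 \<in> (\<phi> ^^ 2) ` carrier curve_group"
    using P0 1 2 by (intro image_eqI[of _ _ "Point i (1 - i)"]) (simp_all add: numeral_2_eq_2)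
  moreover have "n = 0 \<or> n = 1 \<or> n = 2" if "n \<le> 2" for n :: nat using that by linarith
  ultimately have z: "Point 0 0 \<in> (\<phi> ^^ n) ` carrier curve_group" if "n \<le> 2" for n
    using that by metis
  have 3: "\<phi> (Point 0 0) = \<one>\<^bsub>curve_group\<^esub>" by (simp add: \<phi>_def)
  define c where "c n = card ((\<phi> ^^ n) ` carrier curve_group)" for n
  \<comment> \<open>The images of the powers 0, 1 and 2 of \<open>\<phi>\<close> contain the kernel,
    so the first three steps of the chain each halve the order.\<close>
  have c: "c n = 2 * c (n + 1)" if "n \<le> 2" for n
    using card_phi_image[OF phi_image_subgroup z[OF that] _ 3] by (simp add: c_def image_comp)
  have "c 0 = 2 * c 1" "c 2 = 2 * c 3" using c[of 0] c[of 2] by simp_all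
  moreover have "c 1 = 2 * c 2" using c[of 1] by (simp only: one_add_one one_le_numeral)
  ultimately have "c 0 = 8 * c 3" by linarith
  then show ?thesis by (simp add: c_def)
qed

end

text \<open>Translation by 1 permutes the field, so adding 1 to every element leaves the total
  unchanged.\<close>

lemma of_nat_card_finite_field: "of_nat CARD('a) = (0 :: 'a::{field,finite})"
proof -
  have "(\<Sum>x\<in>UNIV. x + 1) = (\<Sum>x\<in>UNIV. (x::'a))"
    by (rule sum.reindex_bij_witness[of _ "\<lambda>x. x - 1" "\<lambda>x. x + 1"]) auto
  then show ?thesis by (simp add: sum.distrib)
qed

section \<open>The group order over a field with G_k elements\<close>

lemma Gnum_sum_two_squares: "Gnum k = (2 ^ k + 1) ^ 2 + (2 ^ k) ^ 2"
proof -
  have "(2::int) ^ (2 * k + 1) = 2 * (2 ^ k) ^ 2" by (simp add: power_even_eq)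
  then show ?thesis unfolding Gnum_def by (simp add: power2_eq_square algebra_simps)
qed

text \<open>With \<open>T = 2 ^ k\<close> and \<open>s = 2 * a\<close>, uniqueness of
  \<open>(T + 1) ^ 2 + T ^ 2\<close> leaves \<open>a ^ 2\<close> two values. Parity and divisibility
  of the order by 8 single out \<open>a = - (T + 1)\<close>, which makes the order
  \<open>2 * T ^ 2\<close>.\<close>

lemma curve_group_iso:
  assumes k: "k \<ge> 1" and p: "prime (Gnum k)" and card: "int CARD('a::{field,finite}) = Gnum k"
  shows "(curve_group :: 'a ec_point monoid) \<cong>
    integer_mod_group (2 ^ k) \<times>\<times> integer_mod_group (2 ^ (k + 1))"
proof -
  define T :: int where "T = 2 ^ k"
  have G: "Gnum k = (T + 1) ^ 2 + T ^ 2" by (simp add: Gnum_sum_two_squares T_def)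
  have T4: "4 dvd 2 * T" "4 dvd T ^ 2"
  proof -
    obtain k' where "k = Suc k'" using k by (cases k) auto
    then have "T = 2 * 2 ^ k'" by (simp add: T_def)
    then show "4 dvd 2 * T" "4 dvd T ^ 2" by (simp_all add: power2_eq_square)
  qed
  have "of_int (int CARD('a)) = (0::'a)" using of_nat_card_finite_field by simp
  then have zero: "(of_int (T + 1) :: 'a) ^ 2 + of_int T ^ 2 = 0"
    unfolding card G by simp
  have two: "(2::'a) \<noteq> 0"
  proof
    assume *: "(2::'a) = 0"
    have "(of_int (T + 1) :: 'a) ^ 2 + of_int T ^ 2 = 2 * (of_int T ^ 2 + of_int T) + 1"
      by (simp add: algebra_simps power2_eq_square)
    then show False using zero * by simp
  qed
  define t :: 'a where "t = of_int T"
  have t: "t \<noteq> 0" using two by (simp add: t_def T_def)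
  \<comment> \<open>A square root of \<open>- 1\<close>, read off from
    \<open>(T + 1) ^ 2 + T ^ 2 = 0\<close> in the field.\<close>
  define i where "i = (t + 1) / t"
  have "(t + 1) ^ 2 = - (t ^ 2)" using zero by (simp add: t_def eq_neg_iff_add_eq_0)
  then have i: "i ^ 2 = - 1" using t by (simp add: i_def power_divide)
  then have "\<chi> (- 1 :: 'a) = 1" using quad_char_square[of i] by fastforce
  then obtain N :: 'a where N: "jacobsthal (1::'a) ^ 2 + jacobsthal N ^ 2 = 4 * int CARD('a)"
    using jacobsthal_sum_of_squares[OF two] by blast
  define s where "s = jacobsthal (1::'a)"
  define u where "u = jacobsthal N"
  have su: "s ^ 2 + u ^ 2 = 4 * Gnum k" using N by (simp add: s_def u_def card)
  have cc: "int (card (curve :: 'a ec_point set)) = 1 + Gnum k + s"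
    using card_curve[OF two] by (simp add: card s_def)
  have "int 8 dvd int (card (curve :: 'a ec_point set))"
    using eight_dvd_card_curve[OF two i] by (simp only: int_dvd_int_iff)
  then have d8: "8 dvd 2 * (1 + T + T ^ 2) + s"
    unfolding cc G by (simp add: algebra_simps power2_eq_square)
  then have "2 dvd s" by presburger
  then obtain a where a: "s = 2 * a" by blast
  have "u ^ 2 = 2 * (2 * (Gnum k - a ^ 2))" using su unfolding a by (simp add: power_mult_distrib)
  then have "even (u ^ 2)" by simp
  then obtain b where b: "u = 2 * b" by (auto elim: evenE)
  have ab: "a ^ 2 + b ^ 2 = Gnum k" using su unfolding a b by (simp add: power_mult_distrib)
  have d4: "4 dvd 1 + T + T ^ 2 + a" using d8 unfolding a by presburger
  have "even T" using T4(1) by presburger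
  then have "odd a" using d4 T4(2) by presburger
  then have "a ^ 2 \<noteq> T ^ 2" using \<open>even T\<close> by (metis even_power pos2)
  then have "a ^ 2 = (T + 1) ^ 2"
    using prime_sum_two_squares_unique[OF p ab G[symmetric]] by blast
  \<comment> \<open>Otherwise the multiple of 4 in \<open>d4\<close> would be
    \<open>2 + 2 * T + T ^ 2\<close>, which is 2 modulo 4.\<close>
  moreover have "a \<noteq> T + 1" using d4 T4 by presburger
  ultimately have "a = - (T + 1)" by (simp add: power2_eq_iff)
  then have "int (card (curve :: 'a ec_point set)) = 2 * T ^ 2"
    unfolding cc G a by (simp add: algebra_simps power2_eq_square)
  also have "\<dots> = int (2 ^ (2 * k + 1))" by (simp add: T_def power_even_eq)
  finally have card_curve: "card (curve :: 'a ec_point set) = 2 ^ (2 * k + 1)"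
    by (simp only: of_nat_eq_iff)
  interpret gaussian_group curve_group "curve_i i" by (rule gaussian_group_curve[OF two i])
  interpret gaussian_two_group curve_group "curve_i i" k
    by unfold_locales (simp add: Coset.order_def card_curve)
  show ?thesis by (rule iso_cyclic_product)
qed

section \<open>Transfer to the residue ring\<close>

text \<open>Links a field given as a record to a type of class \<open>field\<close>, where
  \<open>curve\<close> and its group live.\<close>

locale field_representation = Ring.field R for R (structure) +
  fixes e :: "_ \<Rightarrow> 'f::Fields.field"
  assumes e_bij: "bij_betw e (carrier R) UNIV"
    and e_add: "x \<in> carrier R \<Longrightarrow> y \<in> carrier R \<Longrightarrow> e (x \<oplus> y) = e x + e y"
    and e_mult: "x \<in> carrier R \<Longrightarrow> y \<in> carrier R \<Longrightarrow> e (x \<otimes> y) = e x * e y"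
begin

lemma e_eq_iff: "x \<in> carrier R \<Longrightarrow> y \<in> carrier R \<Longrightarrow> e x = e y \<longleftrightarrow> x = y"
  using e_bij by (auto simp: bij_betw_def inj_on_def)

lemma e_zero: "e \<zero> = 0"
  using e_add[of \<zero> \<zero>] by (simp only: zero_closed l_zero add_cancel_right_right simp_thms)

lemma e_one: "e \<one> = 1"
proof -
  have "e \<one> \<noteq> 0" using e_eq_iff[of \<one> \<zero>] by (simp add: e_zero)
  with e_mult[of \<one> \<one>] show ?thesis by simp
qed

lemma e_neg: "x \<in> carrier R \<Longrightarrow> e (\<ominus> x) = - e x"
  using e_add[of x "\<ominus> x"] by (simp add: e_zero r_neg add_eq_0_iff)

lemma e_minus: "x \<in> carrier R \<Longrightarrow> y \<in> carrier R \<Longrightarrow> e (x \<ominus> y) = e x - e y"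
  by (simp add: minus_eq e_add e_neg)

lemma e_pow: "x \<in> carrier R \<Longrightarrow> e (x [^] (n::nat)) = e x ^ n"
  by (induction n) (simp_all add: e_one e_mult)

lemma e_add_pow: "x \<in> carrier R \<Longrightarrow> e ([(n::nat)] \<cdot> x) = of_nat n * e x"
  by (induction n) (simp_all add: e_zero e_add algebra_simps)

lemma e_inv:
  assumes "x \<in> carrier R" "e x \<noteq> 0"
  shows "inv x \<in> carrier R" "e (inv x) = inverse (e x)"
proof -
  have "x \<noteq> \<zero>" using assms(2) e_zero by auto
  then have x: "x \<in> Units R" using assms(1) by (simp add: field_Units)
  then show "inv x \<in> carrier R" by simp
  moreover have "e (x \<otimes> inv x) = 1" using x by (simp add: e_one)
  ultimately show "e (inv x) = inverse (e x)"
    using assms e_mult[of x "inv x"] by (metis inverse_unique)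
qed

text \<open>The change of variables from \<open>y ^ 2 = x ^ 3 - c ^ 4 x\<close> to
  \<open>y ^ 2 = x ^ 3 - x\<close>; both sides scale by \<open>c ^ 6\<close>.\<close>

fun point_map :: "'f \<Rightarrow> 'a ec_point \<Rightarrow> 'f ec_point" where
  "point_map c Infinity = Infinity"
| "point_map c (Point x y) = Point (e x / c ^ 2) (e y / c ^ 3)"

context
  fixes a c
  assumes two: "(2::'f) \<noteq> 0" and a: "a \<in> carrier R" "e a = - (c ^ 4)" and c: "c \<noteq> 0"
begin

lemma Point_in_ec_points_iff:
  assumes "x \<in> carrier R" "y \<in> carrier R"
  shows "Point x y \<in> ec_points R a \<zero> \<longleftrightarrow> point_map c (Point x y) \<in> curve"
proof -
  have "Point x y \<in> ec_points R a \<zero> \<longleftrightarrow> e (y [^] (2::nat)) = e (x [^] (3::nat) \<oplus> a \<otimes> x \<oplus> \<zero>)"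
    unfolding ec_points_def using assms a by (simp add: e_eq_iff)
  also have "\<dots> \<longleftrightarrow> e y ^ 2 = e x ^ 3 - c ^ 4 * e x"
    using assms a by (simp add: e_pow e_add e_mult)
  also have "e y ^ 2 = c ^ 6 * (e y / c ^ 3) ^ 2" using c by (simp add: power_divide flip: power_mult)
  also have "e x ^ 3 - c ^ 4 * e x = c ^ 6 * ((e x / c ^ 2) ^ 3 - e x / c ^ 2)"
    using c by (simp add: power_divide right_diff_distrib power_numeral_reduce flip: power_mult)
  finally show ?thesis using c by simp
qed

lemma point_map_bij: "bij_betw (point_map c) (ec_points R a \<zero>) curve"
  unfolding bij_betw_def
proof
  have car: "x \<in> carrier R \<and> y \<in> carrier R" if "Point x y \<in> ec_points R a \<zero>" for x y
    using that by (auto simp: ec_points_def)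
  show "inj_on (point_map c) (ec_points R a \<zero>)"
  proof (rule inj_onI)
    fix P Q assume "P \<in> ec_points R a \<zero>" "Q \<in> ec_points R a \<zero>" "point_map c P = point_map c Q"
    then show "P = Q" using c by (cases P; cases Q) (auto dest!: car simp: e_eq_iff)
  qed
  show "point_map c ` ec_points R a \<zero> = curve"
  proof
    show "point_map c ` ec_points R a \<zero> \<subseteq> curve"
    proof
      fix P' assume "P' \<in> point_map c ` ec_points R a \<zero>"
      then obtain P where "P \<in> ec_points R a \<zero>" "P' = point_map c P" by blast
      then show "P' \<in> curve"
      proof (cases P)
        case (Point x y)
        with \<open>P \<in> _\<close> \<open>P' = _\<close> show ?thesis using car Point_in_ec_points_iff by blast
      qed simp
    qed
    show "curve \<subseteq> point_map c ` ec_points R a \<zero>"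
    proof
      fix P' :: "'f ec_point" assume P': "P' \<in> curve"
      show "P' \<in> point_map c ` ec_points R a \<zero>"
      proof (cases P')
        case Infinity
        then show ?thesis by (intro image_eqI[of _ _ Infinity]) (simp_all add: ec_points_def)
      next
        case (Point x' y')
        obtain x where x: "x \<in> carrier R" "e x = c ^ 2 * x'"
          using e_bij unfolding bij_betw_def by (metis UNIV_I imageE)
        obtain y where y: "y \<in> carrier R" "e y = c ^ 3 * y'"
          using e_bij unfolding bij_betw_def by (metis UNIV_I imageE)
        have "point_map c (Point x y) = P'" using x y c Point by simp
        then show ?thesis using Point_in_ec_points_iff[OF x(1) y(1)] P' by (metis imageI)
      qed
    qed
  qed
qed

text \<open>Slopes, abscissas and ordinates have weights 1, 2 and 3 in \<open>c\<close>, and the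
  addition formulas are homogeneous for these weights. Closure is carried back from
  \<open>curve\<close>.\<close>

lemma point_map_add:
  assumes "P \<in> ec_points R a \<zero>" "Q \<in> ec_points R a \<zero>"
  shows "ec_add R a P Q \<in> ec_points R a \<zero>"
    and "point_map c (ec_add R a P Q) = curve_add (point_map c P) (point_map c Q)"
proof -
  have in_curve: "point_map c P \<in> curve" if "P \<in> ec_points R a \<zero>" for P
    using that point_map_bij by (auto simp: bij_betw_def)
  have *: "point_map c (ec_add R a P Q) = curve_add (point_map c P) (point_map c Q)
    \<and> ec_add R a P Q \<in> ec_points R a \<zero>"
  proof (cases "(R, a, P, Q)" rule: ec_add.cases)
    case (3 R' a' x1 y1 x2 y2)
    then have P: "P = Point x1 y1" and Q: "Q = Point x2 y2" by simp_all
    have car: "x1 \<in> carrier R" "y1 \<in> carrier R" "x2 \<in> carrier R" "y2 \<in> carrier R"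
      using assms unfolding P Q by (auto simp: ec_points_def)
    define X1 Y1 X2 Y2 where XY: "X1 = e x1 / c ^ 2" "Y1 = e y1 / c ^ 3" "X2 = e x2 / c ^ 2" "Y2 = e y2 / c ^ 3"
    have e: "e x1 = c ^ 2 * X1" "e y1 = c ^ 3 * Y1" "e x2 = c ^ 2 * X2" "e y2 = c ^ 3 * Y2"
      using c by (simp_all add: XY)
    have on: "Y1 ^ 2 = X1 ^ 3 - X1" "Y2 ^ 2 = X2 ^ 3 - X2"
      using in_curve[OF assms(1)] in_curve[OF assms(2)] unfolding P Q by (simp_all add: XY)
    have "x1 = x2 \<longleftrightarrow> e x1 = e x2" using car by (simp add: e_eq_iff)
    then have x_eq: "x1 = x2 \<longleftrightarrow> X1 = X2" using c by (simp add: e)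
    have "y2 = \<ominus> y1 \<longleftrightarrow> e y2 = e (\<ominus> y1)" using car by (simp add: e_eq_iff)
    also have "\<dots> \<longleftrightarrow> c ^ 3 * Y2 = c ^ 3 * (- Y1)" using car by (simp add: e e_neg)
    also have "\<dots> \<longleftrightarrow> Y2 = - Y1" using c by (simp only: mult_left_cancel power_eq_0_iff simp_thms)
    finally have y_eq: "y2 = \<ominus> y1 \<longleftrightarrow> Y2 = - Y1" .
    show ?thesis
    proof (cases "x1 = x2 \<and> y2 = \<ominus> y1")
      case True
      then have "X1 = X2 \<and> Y2 = - Y1" using x_eq y_eq by blast
      then have "curve_add (Point X1 Y1) (Point X2 Y2) = Infinity" by simp
      moreover have "ec_add R a P Q = Infinity" using True unfolding P Q by simp
      ultimately show ?thesis
        unfolding P Q point_map.simps XY[symmetric] by (simp add: ec_points_def)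
    next
      case False
      then have False': "\<not> (X1 = X2 \<and> Y2 = - Y1)" using x_eq y_eq by blast
      define l where "l = ec_slope R a x1 y1 x2 y2"
      define L where "L = chord_slope X1 Y1 X2 Y2"
      have l: "l \<in> carrier R \<and> e l = c * L"
      proof (cases "x1 = x2")
        case True
        have "Y1 \<noteq> 0" using chord_relations(3)[OF two on False' refl refl refl] True x_eq by blast
        then have nz: "e ([(2::nat)] \<cdot> y1) \<noteq> 0" using c two car by (simp add: e_add_pow e)
        have cl: "[(2::nat)] \<cdot> y1 \<in> carrier R" "[(3::nat)] \<cdot> (x1 [^] (2::nat)) \<oplus> a \<in> carrier R"
          using car a by simp_all
        have "l = ([(3::nat)] \<cdot> (x1 [^] (2::nat)) \<oplus> a) \<otimes> inv ([(2::nat)] \<cdot> y1)"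
          using True by (simp add: l_def ec_slope_def)
        moreover from this have "e l = e ([(3::nat)] \<cdot> (x1 [^] (2::nat)) \<oplus> a) / e ([(2::nat)] \<cdot> y1)"
          using cl e_inv[OF cl(1) nz] by (simp only: e_mult divide_inverse)
        moreover have "e ([(3::nat)] \<cdot> (x1 [^] (2::nat)) \<oplus> a) = 3 * (c ^ 2 * X1) ^ 2 - c ^ 4"
          using car a by (simp add: e_add e_add_pow e_pow e)
        moreover have "e ([(2::nat)] \<cdot> y1) = 2 * (c ^ 3 * Y1)"
          using car by (simp add: e_add_pow e)
        moreover have "3 * (c ^ 2 * X1) ^ 2 - c ^ 4 = c ^ 3 * (c * (3 * X1 ^ 2 - 1))"
          by (simp add: power_mult_distrib algebra_simps power2_eq_square power3_eq_cube power4_eq_xxxx)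
        moreover have "2 * (c ^ 3 * Y1) = c ^ 3 * (2 * Y1)" by (rule mult.left_commute)
        moreover have "c ^ 3 * (c * (3 * X1 ^ 2 - 1)) / (c ^ 3 * (2 * Y1)) = c * ((3 * X1 ^ 2 - 1) / (2 * Y1))"
          using c by simp
        ultimately show ?thesis
          using cl e_inv[OF cl(1) nz] True x_eq by (simp add: L_def chord_slope_def)
      next
        case ne: False
        then have X: "X1 \<noteq> X2" using x_eq by blast
        then have nz: "e (x2 \<ominus> x1) \<noteq> 0" using c car by (simp add: e_minus e)
        have cl: "x2 \<ominus> x1 \<in> carrier R" "y2 \<ominus> y1 \<in> carrier R"
          using car by simp_all
        have "l = (y2 \<ominus> y1) \<otimes> inv (x2 \<ominus> x1)"
          using ne by (simp add: l_def ec_slope_def)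
        moreover from this have "e l = e (y2 \<ominus> y1) / e (x2 \<ominus> x1)"
          using cl e_inv[OF cl(1) nz] by (simp only: e_mult divide_inverse)
        moreover have "\<dots> = (c ^ 3 * Y2 - c ^ 3 * Y1) / (c ^ 2 * X2 - c ^ 2 * X1)"
          using car by (simp only: e_minus e)
        moreover have "\<dots> = (c ^ 2 * (c * (Y2 - Y1))) / (c ^ 2 * (X2 - X1))"
          by (simp add: algebra_simps power2_eq_square power3_eq_cube)
        ultimately show ?thesis
          using c cl e_inv[OF cl(1) nz] X by (simp add: L_def chord_slope_def)
      qed
      define x3 where "x3 = l [^] (2::nat) \<ominus> x1 \<ominus> x2"
      define y3 where "y3 = l \<otimes> (x1 \<ominus> x3) \<ominus> y1"
      define X3 where "X3 = L ^ 2 - X1 - X2"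
      have x3: "x3 \<in> carrier R" "e x3 = c ^ 2 * X3"
        using l car by (simp_all add: x3_def e_minus e_pow e X3_def algebra_simps power_mult_distrib)
      have y3: "y3 \<in> carrier R" "e y3 = c ^ 3 * (L * (X1 - X3) - Y1)"
        using l car x3
        by (simp_all add: y3_def e_minus e_mult e algebra_simps power2_eq_square power3_eq_cube)
      have add: "ec_add R a P Q = Point x3 y3"
        using False unfolding P Q by (auto simp: l_def x3_def y3_def Let_def)
      have "curve_add (point_map c P) (point_map c Q) = Point X3 (L * (X1 - X3) - Y1)"
        using False' unfolding P Q point_map.simps XY[symmetric] curve_add.simps L_def X3_def Let_def by auto
      then have eq: "point_map c (ec_add R a P Q) = curve_add (point_map c P) (point_map c Q)"
        using c x3 y3 unfolding add by simp
      moreover have "curve_add (point_map c P) (point_map c Q) \<in> curve"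
        using in_curve assms by (intro curve_add_in_curve two)
      ultimately show ?thesis
        using Point_in_ec_points_iff[OF x3(1) y3(1)] add by simp
    qed
  qed (use assms in auto)
  then show "ec_add R a P Q \<in> ec_points R a \<zero>"
    "point_map c (ec_add R a P Q) = curve_add (point_map c P) (point_map c Q)" by blast+
qed

lemma ec_group_iso_curve_group: "ec_group R a \<zero> \<cong> (curve_group :: 'f ec_point monoid)"
proof -
  have "point_map c \<in> iso (ec_group R a \<zero>) curve_group"
    using point_map_bij point_map_add
    by (auto simp: iso_def hom_def ec_group_def bij_betw_def)
  then show ?thesis by (auto simp: is_iso_def)
qed

end

end

lemma field_representation_mod_ring:
  "field_representation (residue_ring (int CARD('p))) (of_int :: int \<Rightarrow> 'p::prime_card mod_ring)"
proof -
  let ?p = "int CARD('p)"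
  interpret residues_prime "CARD('p)" "residue_ring ?p"
    by unfold_locales (simp_all add: prime_card)
  have e_mod: "(of_int (z mod ?p) :: 'p mod_ring) = of_int z" for z
    unfolding of_int_of_int_mod_ring by transfer simp
  interpret Ring.field "residue_ring ?p" by (rule is_field)
  show ?thesis
  proof
    have "inj_on (of_int :: int \<Rightarrow> 'p mod_ring) {0..?p - 1}"
      unfolding of_int_of_int_mod_ring
      by (rule inj_on_inverseI[of _ to_int_mod_ring]) simp
    moreover have "z \<in> of_int ` {0..?p - 1}" for z :: "'p mod_ring"
    proof (rule image_eqI)
      show "z = of_int (to_int_mod_ring z)" by (simp add: of_int_of_int_mod_ring)
      show "to_int_mod_ring z \<in> {0..?p - 1}" using range_to_int_mod_ring[where 'a = 'p] by auto
    qed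
    ultimately show "bij_betw of_int (carrier (residue_ring ?p)) (UNIV :: 'p mod_ring set)"
      unfolding bij_betw_def res_carrier_eq by blast
  qed (simp_all add: res_add_eq res_mult_eq e_mod)
qed

text \<open>The claim for the modulus \<open>p\<close> with all other variables bound, so that a
  prime violating it can be chosen.\<close>

definition conclusion_at :: "int \<Rightarrow> bool"
  where "conclusion_at p \<longleftrightarrow> (\<forall>k m c. k \<ge> 1 \<and> p = Gnum k \<and> \<not> [m = 0] (mod p) \<and> [m = c ^ 4] (mod p) \<longrightarrow>
    ec_group (residue_ring p) ((- m) mod p) 0 \<cong>
      integer_mod_group (2 ^ k) \<times>\<times> integer_mod_group (2 ^ (k + 1)))"

lemma conclusion_at_card: "conclusion_at (int CARD('p::prime_card))"
  unfolding conclusion_at_def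
proof (intro allI impI, elim conjE)
  let ?p = "int CARD('p)"
  fix k :: nat and m c :: int
  assume k: "k \<ge> 1" and p: "?p = Gnum k" and m: "\<not> [m = 0] (mod ?p)" and c: "[m = c ^ 4] (mod ?p)"
  let ?e = "of_int :: int \<Rightarrow> 'p mod_ring"
  interpret field_representation "residue_ring ?p" ?e by (rule field_representation_mod_ring)
  interpret residues_prime "CARD('p)" "residue_ring ?p"
    by unfold_locales (simp_all add: prime_card)
  have e_eq: "?e x = ?e y \<longleftrightarrow> [x = y] (mod ?p)" for x y
    unfolding of_int_of_int_mod_ring cong_def by transfer simp
  have "?e m = ?e c ^ 4" using c unfolding e_eq[symmetric] by simp
  moreover have "?e m \<noteq> 0" using m unfolding e_eq[symmetric] by simp
  moreover have "?e ((- m) mod ?p) = ?e (- m)" unfolding e_eq by (simp add: cong_def)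
  \<comment> \<open>As \<open>m\<close> is a nonzero fourth power, the coefficient has the form that
    the change of variables requires.\<close>
  ultimately have a: "?e ((- m) mod ?p) = - (?e c ^ 4)" "?e c \<noteq> 0" by auto
  have "odd ?p" unfolding p Gnum_def by simp
  then have "\<not> [2 = 0] (mod ?p)" using prime_card[where 'a = 'p]
    by (metis cong_0_iff even_numeral even_of_nat odd_one of_nat_1 of_nat_dvd_iff of_nat_numeral primes_dvd_imp_eq two_is_prime_nat)
  then have two: "(2 :: 'p mod_ring) \<noteq> 0" using e_eq[of 2 0] by simp
  have "ec_group (residue_ring ?p) ((- m) mod ?p) \<zero>\<^bsub>residue_ring ?p\<^esub> \<cong> (curve_group :: 'p mod_ring ec_point monoid)"
    by (rule ec_group_iso_curve_group[OF two _ a]) simp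
  also have "(curve_group :: 'p mod_ring ec_point monoid) \<cong>
      integer_mod_group (2 ^ k) \<times>\<times> integer_mod_group (2 ^ (k + 1))"
    by (rule curve_group_iso) (use k p prime_card[where 'a = 'p] in \<open>simp_all flip: p\<close>)
  finally show "ec_group (residue_ring ?p) ((- m) mod ?p) 0 \<cong>
      integer_mod_group (2 ^ k) \<times>\<times> integer_mod_group (2 ^ (k + 1))"
    by (simp add: res_zero_eq)
qed

text \<open>Field arithmetic in the type class \<open>field\<close> needs a type with \<open>p\<close> elements, but types cannot
  depend on \<open>p\<close>.  One type suffices: its cardinality is a prime chosen to violate the claim if
  any prime does.\<close>

definition critical_prime :: nat
  where "critical_prime =
    (if \<exists>p. prime p \<and> \<not> conclusion_at (int p)
     then SOME p. prime p \<and> \<not> conclusion_at (int p) else 2)"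

lemma prime_critical_prime: "prime critical_prime"
  unfolding critical_prime_def by (auto intro: someI2_ex)

typedef critical = "{..<critical_prime}"
  using prime_gt_0_nat[OF prime_critical_prime] by blast

lemma card_critical: "CARD(critical) = critical_prime"
  using type_definition.card[OF type_definition_critical] by simp

instance critical :: prime_card
  by standard (simp add: card_critical prime_critical_prime)

text \<open>Any violation would make \<open>critical_prime\<close> a violation too, but there
  \<open>critical\<close> supplies a type of the right cardinality.\<close>

lemma conclusion_at_prime:
  assumes "prime p"
  shows "conclusion_at (int p)"
proof (rule ccontr)
  assume "\<not> ?thesis"
  with assms have ex: "\<exists>p. prime p \<and> \<not> conclusion_at (int p)" by blast
  then have "critical_prime = (SOME p. prime p \<and> \<not> conclusion_at (int p))"
    unfolding critical_prime_def by simp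
  with someI_ex[OF ex] have "\<not> conclusion_at (int critical_prime)" by simp
  then show False using conclusion_at_card[where 'p = critical] by (simp add: card_critical)
qed

theorem theorem2p7:
  fixes k :: nat and m :: int
  assumes "k \<ge> 1"
    and "prime (Gnum k)"
    and "\<not> [m = 0] (mod Gnum k)"
    and "\<exists>c::int. [m = c ^ 4] (mod Gnum k)"
  shows "ec_group (residue_ring (Gnum k)) ((- m) mod Gnum k) 0 \<cong>
           integer_mod_group (2 ^ k) \<times>\<times> integer_mod_group (2 ^ (k + 1))"
proof -
  obtain p where p: "Gnum k = int p" "prime p"
    using assms(2) by (metis prime_ge_0_int nonneg_int_cases prime_int_nat_transfer prime_nat_int_transfer)
  show ?thesis
    using conclusion_at_prime[OF p(2)] assms unfolding conclusion_at_def p(1)[symmetric] by blast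
qed

end
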